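(* Let $\mathbf{x}^*\in S$, $r>0$, and assume: (i) $\mathbf{R}:\mathbb{R}^N\to\mathbb{R}^m$ is continuously differentiable and its Jacobian $\mathbf{J}$ is $L$-Lipschitz continuous on $\mathbb{R}^N$; (ii) there is $\omega>0$ with $\omega\,\mathrm{dist}(\mathbf{x},S)\le\|\mathbf{J}(\mathbf{x})^\top\mathbf{R}(\mathbf{x})\|$ for every $\mathbf{x}\in B(\mathbf{x}^*,r)$; (iii) there is $\sigma>0$ with $\|(\mathbf{J}(\mathbf{x})-\mathbf{J}(\bar{\mathbf{z}}))^\top\mathbf{R}(\bar{\mathbf{z}})\|\le\sigma\|\mathbf{x}-\bar{\mathbf{z}}\|$ for every $\mathbf{x}\in B(\mathbf{x}^*,r)$ and every $\bar{\mathbf{z}}\in B(\mathbf{x}^*,r)\cap S$. Let $\{\mathbf{x}^k\}$ be generated by the LMS algorithm, with constants $L_2,L_3,L_4,c_1,\mu_{\max},\rho_{\max}$ as described in the context. Suppose there exists $\eta\in(0,1)$ such that $$\eta\omega>\mu_{\max}c_1+L_3\rho_{\max}+(2+c_1)\sigma,$$ and define $$\varepsilon=\min\left\{\frac{\eta\omega-(c_1\mu_{\max}+\rho_{\max}L_3+(2+c_1)\sigma)}{L_4c_1^2+LL_2(1+c_1)(2+c_1)},\ \frac12\,\frac{r(1-\eta)}{1+c_1-\eta}\right\}.$$ If $\mathbf{x}^0\in B(\mathbf{x}^*,\varepsilon)$, then $\mathrm{dist}(\mathbf{x}^k,S)\to0$ linearly and $\mathbf{x}^k\to\bar{\mathbf{x}}\in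 S\cap B(\mathbf{x}^*,r/2)$.
   Context: Norms are Euclidean (spectral for matrices). $\mathbf{R}:\mathbb{R}^N\to\mathbb{R}^m$ is the residual vector, $\mathbf{J}(\mathbf{x})$ its Jacobian, $\mathbf{F}(\mathbf{x})=\frac12\|\mathbf{R}(\mathbf{x})\|^2$, $\mathbf{g}(\mathbf{x})=\mathbf{J}(\mathbf{x})^\top\mathbf{R}(\mathbf{x})$, $S=\{\mathbf{x}\in\mathbb{R}^N:\mathbf{J}(\mathbf{x})^\top\mathbf{R}(\mathbf{x})=0\}$, $\mathrm{dist}(\cdot,S)$ is Euclidean distance to $S$, $B(\mathbf{x},r)$ the ball of radius $r$ about $\mathbf{x}$. A partition $I_1,\dots,I_K$ of $\{1,\dots,N\}$ is fixed; $\mathbf{H}(\mathbf{x})$ is the block diagonal part of $\mathbf{J}(\mathbf{x})^\top\mathbf{J}(\mathbf{x})$ with respect to it (entries $(i,j)$ with $i,j$ in the same $I_s$ are kept, all others set to zero), and $\mathbf{B}(\mathbf{x})=\mathbf{J}(\mathbf{x})^\top\mathbf{J}(\mathbf{x})-\mathbf{H}(\mathbf{x})$. A sub- or superscript $k$ denotes evaluation at $\mathbf{x}^k$. LMS algorithm. Parameters: $c\in(0,1)$, $b\in(0,1)$, $\hat\eta\in[0,1)$ (unrelated to the $\eta$ of the claim), $0\le\ell_{\min}<\ell_0$; starting point $\mathbf{x}^0$. Iteration $k\ge0$: 1. Set $\mu_k=1+\frac{(1+b)^2}{1-b}\max_{i=0,1,2,3}\hat a_i^k$, where $\hat a_0^k=\frac{\ell_k^2}{4}\|\mathbf{H}_k\|\|\mathbf{J}_k\|\|\mathbf{R}_k\|$,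 $\hat a_1^k=\frac{\ell_k^2}{4}\|\mathbf{J}_k\|\|\mathbf{R}_k\|+\ell_k\|\mathbf{H}_k\|\|\mathbf{J}_k\|^2\|\mathbf{R}_k\|$, $\hat a_2^k=\|\mathbf{H}_k\|\|\mathbf{J}_k\|^2+\ell_k\|\mathbf{H}_k\|\|\mathbf{R}_k\|+\ell_k\|\mathbf{J}_k\|^2\|\mathbf{R}_k\|$, $\hat a_3^k=\|\mathbf{J}_k\|^2+\ell_k\|\mathbf{R}_k\|$. 2. Choose $\beta_k\in\mathbb{R}$ with $\|\beta_k\mathbf{B}_k\|\le\frac{b\mu_k}{\|\mathbf{H}_k\|+\mu_k}$. 3. Set $\gamma_k=\|\mathbf{I}-\beta_k\mathbf{B}_k\|$. 4. Let $\mathbf{d}^k$ solve $(\mathbf{H}_k+\mu_k\mathbf{I})\mathbf{d}^k=(\beta_k\mathbf{B}_k-\mathbf{I})\mathbf{g}^k$. 5. Use backtracking to find the largest positive $t_k\le\min\{1,1/\gamma_k\}$ such that $\mathbf{F}(\mathbf{x}^k+t_k\mathbf{d}^k)\le\mathbf{F}(\mathbf{x}^k)+ct_k(\mathbf{d}^k)^\top\mathbf{g}^k$. 6. Set $\mathbf{x}^{k+1}=\mathbf{x}^k+t_k\mathbf{d}^k$. 7. If $t_k<\min\{1,1/\gamma_k\}$, set $\ell_{k+1}=2\ell_k$. Otherwise let $A_k=\mathbf{F}(\mathbf{x}^{k+1})-\mathbf{F}(\mathbf{x}^k)$ and $P_k=\mathbf{F}(\mathbf{x}^k)-\|\mathbf{R}_k+\mathbf{J}_k\mathbf{d}^k\|^2-\mu_k\|\mathbf{d}^k\|^2$;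 set $\ell_{k+1}=\max\{\ell_{\min},\ell_k/2\}$ if $A_k>\hat\eta P_k$, and $\ell_{k+1}=\ell_k$ otherwise. Constants: $\mu_{\max}$ is the maximum of $\mu_k$ over $k$. $\rho_k$ is the relative residual of $\mathbf{d}^k$ in the full Levenberg-Marquardt system, i.e. $\|\mathbf{g}^k+(\mathbf{J}_k^\top\mathbf{J}_k+\mu_k\mathbf{I})\mathbf{d}^k\|\le\rho_k\|\mathbf{g}^k\|$, and $\rho_{\max}=\max_k\rho_k$. $L_2,L_3,L_4>0$ are constants such that for all $\mathbf{x},\mathbf{y}\in B(\mathbf{x}^*,r)$: $\|\mathbf{R}(\mathbf{x})-\mathbf{R}(\mathbf{y})\|\le L_2\|\mathbf{x}-\mathbf{y}\|$, $\|\mathbf{g}(\mathbf{x})-\mathbf{g}(\mathbf{y})\|\le L_3\|\mathbf{x}-\mathbf{y}\|$, and $\|\mathbf{g}(\mathbf{x})-\mathbf{g}(\mathbf{y})-\mathbf{J}(\mathbf{x})^\top\mathbf{J}(\mathbf{x})(\mathbf{x}-\mathbf{y})\|\le L_4\|\mathbf{x}-\mathbf{y}\|^2+\|(\mathbf{J}(\mathbf{x})-\mathbf{J}(\mathbf{y}))^\top\mathbf{R}(\mathbf{y})\|$. The radius $r$ and the constant $c_1>0$ are such that $\|\mathbf{d}^k\|\le c_1\,\mathrm{dist}(\mathbf{x}^k,S)$ whenever $\mathbf{x}^k\in B(\mathbf{x}^*,r)$. *)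

theory Defs
  imports "HOL-Analysis.Analysis" "HOL-Library.Disjoint_Sets"
begin

(* The library norm on real^'n^'m is the Frobenius norm; matrix norms here are spectral. *)
definition spec_norm :: "real^'n^'m \<Rightarrow> real" where
  "spec_norm A = onorm ((*v) A)"

definition Jac :: "(real^'n \<Rightarrow> real^'m) \<Rightarrow> real^'n \<Rightarrow> real^'n^'m" where
  "Jac R x = jacobian R (at x)"

definition cont_diff :: "(real^'n \<Rightarrow> real^'m) \<Rightarrow> bool" where
  "cont_diff R \<longleftrightarrow> (\<forall>x. R differentiable (at x)) \<and> continuous_on UNIV (Jac R)"

definition obj :: "(real^'n \<Rightarrow> real^'m) \<Rightarrow> real^'n \<Rightarrow> real" where
  "obj R x = (norm (R x))\<^sup>2 / 2"

definition grad :: "(real^'n \<Rightarrow> real^'m) \<Rightarrow> real^'n \<Rightarrow> real^'n" where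
  "grad R x = transpose (Jac R x) *v R x"

definition stationary :: "(real^'n \<Rightarrow> real^'m) \<Rightarrow> (real^'n) set" where
  "stationary R = {x. transpose (Jac R x) *v R x = 0}"

definition gram :: "(real^'n \<Rightarrow> real^'m) \<Rightarrow> real^'n \<Rightarrow> real^'n^'n" where
  "gram R x = transpose (Jac R x) ** Jac R x"

definition block_diag :: "'n set set \<Rightarrow> real^'n^'n \<Rightarrow> real^'n^'n" where
  "block_diag P A = (\<chi> i j. if \<exists>I\<in>P. i \<in> I \<and> j \<in> I then A $ i $ j else 0)"

definition Hmat :: "(real^'n \<Rightarrow> real^'m) \<Rightarrow> 'n set set \<Rightarrow> real^'n \<Rightarrow> real^'n^'n" where
  "Hmat R P x = block_diag P (gram R x)"

definition Bmat :: "(real^'n \<Rightarrow> real^'m) \<Rightarrow> 'n set set \<Rightarrow> real^'n \<Rightarrow> real^'n^'n" where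
  "Bmat R P x = gram R x - Hmat R P x"

definition lms_mu ::
    "(real^'n \<Rightarrow> real^'m) \<Rightarrow> 'n set set \<Rightarrow> real \<Rightarrow> real \<Rightarrow> real^'n \<Rightarrow> real" where
  "lms_mu R P b l x =
    (let h = spec_norm (Hmat R P x); j = spec_norm (Jac R x); \<rho> = norm (R x);
         a0 = l\<^sup>2 / 4 * h * j * \<rho>;
         a1 = l\<^sup>2 / 4 * j * \<rho> + l * h * j\<^sup>2 * \<rho>;
         a2 = h * j\<^sup>2 + l * h * \<rho> + l * j\<^sup>2 * \<rho>;
         a3 = j\<^sup>2 + l * \<rho>
     in 1 + (1 + b)\<^sup>2 / (1 - b) * Max {a0, a1, a2, a3})"

definition lms_gamma ::
    "(real^'n \<Rightarrow> real^'m) \<Rightarrow> 'n set set \<Rightarrow> real \<Rightarrow> real^'n \<Rightarrow> real" where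
  "lms_gamma R P \<beta> x = spec_norm (mat 1 - \<beta> *\<^sub>R Bmat R P x)"

definition admissible_step ::
    "(real^'n \<Rightarrow> real^'m) \<Rightarrow> real \<Rightarrow> real \<Rightarrow> real^'n \<Rightarrow> real^'n \<Rightarrow> real \<Rightarrow> bool" where
  "admissible_step R c \<gamma> x d t \<longleftrightarrow>
     0 < t \<and> t \<le> min 1 (1 / \<gamma>) \<and> obj R (x + t *\<^sub>R d) \<le> obj R x + c * t * (d \<bullet> grad R x)"

definition lms_sequence ::
    "(real^'n \<Rightarrow> real^'m) \<Rightarrow> 'n set set \<Rightarrow> real \<Rightarrow> real \<Rightarrow> real \<Rightarrow> real \<Rightarrow>
     (nat \<Rightarrow> real^'n) \<Rightarrow> (nat \<Rightarrow> real) \<Rightarrow> (nat \<Rightarrow> real) \<Rightarrow> (nat \<Rightarrow> real^'n) \<Rightarrow> (nat \<Rightarrow> real) \<Rightarrow> bool" where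
  "lms_sequence R P c b \<eta>hat lmin x l \<beta> d t \<longleftrightarrow>
    (\<forall>k. let H = Hmat R P (x k); B = Bmat R P (x k); g = grad R (x k);
             \<mu> = lms_mu R P b (l k) (x k);
             \<gamma> = lms_gamma R P (\<beta> k) (x k);
             A = obj R (x (Suc k)) - obj R (x k);
             Pr = obj R (x k) - (norm (R (x k) + Jac R (x k) *v d k))\<^sup>2 - \<mu> * (norm (d k))\<^sup>2
         in spec_norm (\<beta> k *\<^sub>R B) \<le> b * \<mu> / (spec_norm H + \<mu>)
          \<and> (H + \<mu> *\<^sub>R mat 1) *v d k = (\<beta> k *\<^sub>R B - mat 1) *v g
          \<and> admissible_step R c \<gamma> (x k) (d k) (t k)
          \<and> (\<forall>s. admissible_step R c \<gamma> (x k) (d k) s \<longrightarrow> s \<le> t k)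
          \<and> x (Suc k) = x k + t k *\<^sub>R d k
          \<and> l (Suc k) = (if t k < min 1 (1 / \<gamma>) then 2 * l k
                         else if A > \<eta>hat * Pr then max lmin (l k / 2)
                         else l k))"

(* Q-linear convergence; the ratio bound is required for all sufficiently large k. *)
definition tends_to_zero_linearly :: "(nat \<Rightarrow> real) \<Rightarrow> bool" where
  "tends_to_zero_linearly u \<longleftrightarrow>
     u \<longlonglongrightarrow> 0 \<and> (\<exists>q. 0 < q \<and> q < 1 \<and> (\<forall>\<^sub>F k in sequentially. \<bar>u (Suc k)\<bar> \<le> q * \<bar>u k\<bar>))"

end

theory Submission
  imports Defs
begin

text \<open>Let \<open>x\<close> be an iterate with direction \<open>d\<close>, \<open>e\<close> its distance to \<open>S\<close>, and \<open>z\<close> a nearest stationary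
  point of \<open>w = x + t *\<^sub>R d\<close>. Because \<open>z\<close> stays nearest to first order when it is moved, the error
  bound yields \<open>\<omega> * ((w - z) \<bullet> v) \<le> norm (w - z) * (norm (gram R z *v v) + \<sigma> * norm v)\<close> for every \<open>v\<close>.
  For \<open>v = x + d - z\<close> the right-hand side is at most \<open>\<eta> * \<omega> * e * norm (w - z)\<close>, since \<open>d\<close> almost solves
  the Levenberg-Marquardt system. This is a differential inequality for the distance to \<open>S\<close> along the
  step; integrated, it gives \<open>infdist w S \<le> (1 - t * (1 - \<eta>)) * e\<close> for every \<open>t \<in> {0..1}\<close>, so a step
  size below 1 does no harm. Sufficient decrease keeps the step sizes away from 0, hence the linear
  rate, and \<open>norm (x - xstar) + c1 / (1 - \<eta>) * e\<close> never increases, so the iterates stay in the ball.\<close>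

section \<open>Spectral norm and transposes\<close>

lemma norm_matrix_vector_le: "norm (A *v v) \<le> spec_norm A * norm (v :: real^'n)" for A :: "real^'n^'m"
  unfolding spec_norm_def by (rule onorm[OF matrix_vector_mul_bounded_linear])

lemma spec_norm_nonneg: "0 \<le> spec_norm (A :: real^'n^'m)"
  unfolding spec_norm_def by (rule onorm_pos_le[OF matrix_vector_mul_bounded_linear])

lemma inner_transpose: "(transpose A *v x) \<bullet> y = x \<bullet> (A *v y)" for A :: "real^'n^'m"
  by (simp add: dot_lmul_matrix)

text \<open>Pairing \<open>transpose A *v y\<close> with itself moves one factor back to
  \<open>A\<close>. The bound \<open>K\<close> is left free because it is applied both to
  \<open>spec_norm A\<close> and to a local Lipschitz constant of \<open>R\<close>.\<close>

lemma norm_transpose_vector_le_bound: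
  fixes A :: "real^'n^'m"
  assumes "\<And>v. norm (A *v v) \<le> K * norm v"
  shows "norm (transpose A *v y) \<le> K * norm y"
proof (cases "transpose A *v y = 0")
  case True
  \<comment> \<open>The all-ones vector is nonzero, so the hypothesis at this vector forces
    \<open>K\<close> to be nonnegative.\<close>
  have "0 \<le> norm (A *v (\<chi> i. 1))" by simp
  also have "\<dots> \<le> K * norm ((\<chi> i. 1) :: real^'n)" by (rule assms)
  finally have "0 \<le> K"
    by (metis (no_types, lifting) norm_eq_zero norm_ge_zero vec_lambda_beta zero_index
        zero_le_mult_iff zero_neq_one order_antisym)
  then show ?thesis using True by simp
next
  case False
  have "norm (transpose A *v y) * norm (transpose A *v y) = y \<bullet> (A *v (transpose A *v y))"
    by (metis inner_transpose norm_eq_sqrt_inner real_sqrt_mult_self inner_ge_zero abs_of_nonneg)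
  also have "\<dots> \<le> norm y * norm (A *v (transpose A *v y))"
    by (rule norm_cauchy_schwarz)
  also have "\<dots> \<le> norm y * (K * norm (transpose A *v y))"
    by (intro mult_left_mono assms) auto
  finally have "norm (transpose A *v y) * norm (transpose A *v y)
      \<le> (K * norm y) * norm (transpose A *v y)"
    by (simp add: mult_ac)
  then show ?thesis using False by (simp only: mult_le_cancel_right) auto
qed

lemma norm_transpose_vector_le:
  "norm (transpose A *v y) \<le> spec_norm A * norm y" for A :: "real^'n^'m"
  by (rule norm_transpose_vector_le_bound) (rule norm_matrix_vector_le)

lemma transpose_diff: "transpose (A - B) = transpose A - transpose (B :: real^'n^'m)"
  by (simp add: transpose_def vec_eq_iff)

lemma gram_vector: "gram R x *v v = transpose (Jac R x) *v (Jac R x *v v)"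
  by (simp add: gram_def matrix_vector_mul_assoc)

section \<open>Calculus for the residual map and its Jacobian\<close>

lemma Jac_has_derivative:
  assumes "cont_diff R"
  shows "(R has_derivative (\<lambda>h. Jac R x *v h)) (at x)"
  using assms jacobian_works[of R "at x"] by (auto simp: cont_diff_def Jac_def)

lemma Jac_has_vector_derivative:
  assumes "cont_diff R"
  shows "((\<lambda>s. R (x + s *\<^sub>R v)) has_vector_derivative Jac R (x + s *\<^sub>R v) *v v) (at s within T)"
proof -
  have "((\<lambda>s. x + s *\<^sub>R v) has_derivative (\<lambda>h. h *\<^sub>R v)) (at s within T)"
    by (auto intro!: derivative_eq_intros)
  from has_derivative_compose[OF this Jac_has_derivative[OF assms]]
  show ?thesis
    by (simp add: has_vector_derivative_def matrix_vector_mult_scaleR)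
qed

text \<open>Closedness supplies nearest stationary points and makes the limit of the iterates
  stationary.\<close>

lemma closed_stationary:
  fixes R :: "real^'n \<Rightarrow> real^'m"
  assumes "cont_diff R"
  shows "closed (stationary R)"
proof -
  have J: "continuous_on UNIV (Jac R)" using assms by (simp add: cont_diff_def)
  have R: "continuous_on UNIV R"
    using assms by (auto simp: cont_diff_def intro!: continuous_at_imp_continuous_on
        differentiable_imp_continuous_within)
  have "continuous_on UNIV (\<lambda>x. transpose (Jac R x) *v R x)"
    unfolding matrix_vector_mult_def transpose_def
    by (intro continuous_on_vec_lambda continuous_intros) (use J R in \<open>auto intro!: continuous_intros\<close>)
  then show ?thesis
    unfolding stationary_def using continuous_closed_preimage_constant[of UNIV _ 0] by force
qed

lemma norm_Taylor_remainder_le: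
  fixes R :: "real^'n \<Rightarrow> real^'m"
  assumes R: "cont_diff R"
    and lip: "\<And>x y. spec_norm (Jac R x - Jac R y) \<le> L * norm (x - y)"
  shows "norm (R (z + v) - R z - Jac R z *v v) \<le> L / 2 * (norm v)\<^sup>2"
proof -
  define E where "E = R (z + v) - R z - Jac R z *v v"
  \<comment> \<open>Pairing with the remainder \<open>E\<close> itself reduces the vector estimate
    to monotonicity of a real function; at \<open>s = 1\<close> the pairing is the square of
    \<open>norm E\<close>.\<close>
  define \<phi> where "\<phi> s = E \<bullet> (R (z + s *\<^sub>R v) - R z - s *\<^sub>R (Jac R z *v v))
      - L / 2 * (norm v)\<^sup>2 * norm E * s\<^sup>2" for s
  have D: "(\<phi> has_real_derivative
      E \<bullet> (Jac R (z + s *\<^sub>R v) *v v - Jac R z *v v) - L * (norm v)\<^sup>2 * norm E * s) (at s)" for s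
  proof -
    have *: "((\<lambda>s. R (z + s *\<^sub>R v)) has_derivative (\<lambda>h. h *\<^sub>R (Jac R (z + s *\<^sub>R v) *v v))) (at s)"
      using Jac_has_vector_derivative[OF R, of z v s UNIV] by (simp add: has_vector_derivative_def)
    show ?thesis
      unfolding \<phi>_def has_field_derivative_def
      by (auto intro!: derivative_eq_intros * ext simp: inner_diff_right algebra_simps)
  qed
  have nonpos: "E \<bullet> (Jac R (z + s *\<^sub>R v) *v v - Jac R z *v v) - L * (norm v)\<^sup>2 * norm E * s \<le> 0"
    if "0 \<le> s" for s
  proof -
    have "E \<bullet> (Jac R (z + s *\<^sub>R v) *v v - Jac R z *v v)
        \<le> norm E * norm ((Jac R (z + s *\<^sub>R v) - Jac R z) *v v)"
      by (simp add: matrix_vector_mult_diff_rdistrib norm_cauchy_schwarz)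
    also have "\<dots> \<le> norm E * (spec_norm (Jac R (z + s *\<^sub>R v) - Jac R z) * norm v)"
      by (intro mult_left_mono norm_matrix_vector_le) auto
    also have "\<dots> \<le> norm E * ((L * (s * norm v)) * norm v)"
      using lip[of "z + s *\<^sub>R v" z] that by (intro mult_left_mono mult_right_mono) auto
    finally show ?thesis by (simp add: power2_eq_square mult_ac)
  qed
  have "\<phi> 1 \<le> \<phi> 0"
    by (rule DERIV_nonpos_imp_nonincreasing) (use D nonpos in \<open>auto intro!: exI\<close>)
  then have "norm E * norm E \<le> (L / 2 * (norm v)\<^sup>2) * norm E"
    by (simp add: \<phi>_def E_def[symmetric] power2_norm_eq_inner power2_eq_square
        flip: power2_norm_eq_inner)
  moreover have "0 \<le> L / 2 * (norm v)\<^sup>2"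
    using order_trans[OF spec_norm_nonneg lip[of v 0]]
    by (cases "v = 0") (auto simp: zero_le_mult_iff)
  ultimately show ?thesis
    unfolding E_def[symmetric] by (cases "E = 0") (auto simp: mult_le_cancel_right)
qed

section \<open>Elementary inequalities\<close>

text \<open>Division by \<open>s\<close> and a limit at 0 remove the quadratic term. Second-order
  estimates below become first-order bounds in this way.\<close>

lemma le_if_le_up_to_square:
  fixes a b C s0 :: real
  assumes "0 < s0" and le: "\<And>s. 0 < s \<Longrightarrow> s < s0 \<Longrightarrow> s * a \<le> s * b + C * s\<^sup>2"
  shows "a \<le> b"
proof (rule field_le_epsilon)
  fix \<epsilon> :: real assume "0 < \<epsilon>"
  define s where "s = min (s0 / 2) (\<epsilon> / (\<bar>C\<bar> + 1))"
  have s: "0 < s" "s < s0" "s \<le> \<epsilon> / (\<bar>C\<bar> + 1)"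
    using \<open>0 < s0\<close> \<open>0 < \<epsilon>\<close> by (auto simp: s_def)
  have "s * a \<le> s * (b + C * s)"
    using le[OF s(1,2)] by (simp add: power2_eq_square algebra_simps)
  then have "a \<le> b + C * s" using s(1) by simp
  also have "C * s \<le> (\<bar>C\<bar> + 1) * s" using s(1) by (intro mult_right_mono) auto
  also have "\<dots> \<le> \<epsilon>" using s(3) by (simp add: field_simps)
  finally show "a \<le> b + \<epsilon>" by simp
qed

lemma norm_add_scaleR_squared:
  "(norm (u + h *\<^sub>R d))\<^sup>2 = (norm u)\<^sup>2 + 2 * h * (u \<bullet> d) + h\<^sup>2 * (norm (d :: 'a::real_inner))\<^sup>2"
  unfolding power2_norm_eq_inner by (simp add: inner_simps inner_commute power2_eq_square)

lemma small_step_in_ball: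
  fixes z v :: "'a::real_normed_vector"
  assumes "z \<in> ball a r"
  obtains s0 where "0 < s0" "\<And>s. 0 < s \<Longrightarrow> s < s0 \<Longrightarrow> z + s *\<^sub>R v \<in> ball a r"
proof
  define s0 where "s0 = (r - dist a z) / (norm v + 1)"
  show "0 < s0" using assms by (auto simp: s0_def intro!: divide_pos_pos add_nonneg_pos)
  fix s assume s: "0 < s" "s < s0"
  have "s * norm v \<le> s * (norm v + 1)" using s(1) by simp
  also have "\<dots> < r - dist a z"
    using s(2) by (simp add: s0_def pos_less_divide_eq add_nonneg_pos)
  finally have "dist a z + dist z (z + s *\<^sub>R v) < r"
    using s(1) by (simp add: dist_norm)
  then show "z + s *\<^sub>R v \<in> ball a r"
    by (simp add: dist_triangle_lt[OF _, of a z])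
      (metis dist_triangle le_less_trans)
qed

section \<open>Descent along the damped block direction\<close>

text \<open>Expanding the nonnegative quadratic form at \<open>K *\<^sub>R y - A *v y\<close> and
  using the bound at \<open>A *v y\<close> replaces a diagonalisation of \<open>A\<close>.\<close>

lemma psd_norm_squared_le:
  fixes A :: "real^'n^'n"
  assumes sym: "transpose A = A" and psd: "\<And>y. 0 \<le> y \<bullet> (A *v y)"
    and bound: "\<And>y. norm (A *v y) \<le> K * norm y" and K: "0 < K"
  shows "(norm (A *v y))\<^sup>2 \<le> K * (y \<bullet> (A *v y))"
proof -
  define u where "u = A *v y"
  have yu: "y \<bullet> (A *v u) = u \<bullet> u"
    using inner_transpose[of A y u] by (simp add: sym u_def)
  have "u \<bullet> (A *v u) \<le> norm u * (K * norm u)"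
    by (rule order_trans[OF norm_cauchy_schwarz]) (intro mult_left_mono bound norm_ge_zero)
  then have "u \<bullet> (A *v u) \<le> K * (u \<bullet> u)"
    by (simp add: power2_norm_eq_inner[symmetric] power2_eq_square mult_ac)
  moreover have "0 \<le> (K *\<^sub>R y - u) \<bullet> (A *v (K *\<^sub>R y - u))"
    by (rule psd)
  then have "0 \<le> K * (K * (y \<bullet> u)) - 2 * K * (u \<bullet> u) + u \<bullet> (A *v u)"
    by (simp add: matrix_vector_mult_diff_distrib matrix_vector_mult_scaleR inner_diff_left
        inner_diff_right yu u_def[symmetric] algebra_simps)
  ultimately have "K * (u \<bullet> u) \<le> K * (K * (y \<bullet> u))"
    by linarith
  then show ?thesis using K by (simp add: u_def power2_norm_eq_inner)
qed

text \<open>With \<open>A = H + \<mu> *\<^sub>R mat 1\<close> and \<open>A *v y = g\<close>,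
  symmetry gives \<open>d \<bullet> g = (C *v g) \<bullet> y - y \<bullet> g\<close>. Here
  \<open>y \<bullet> g\<close> is at least \<open>(norm g)\<^sup>2 / (spec_norm H + \<mu>)\<close>,
  and the bound on \<open>C\<close> is scaled so that the other term is at most the fraction
  \<open>b\<close> of this.\<close>

lemma damped_direction_descent:
  fixes H C :: "real^'n^'n"
  assumes sym: "transpose H = H" and psd: "\<And>y. 0 \<le> y \<bullet> (H *v y)"
    and \<mu>: "0 < \<mu>" and b: "0 < b" "b < 1"
    and C: "spec_norm C \<le> b * \<mu> / (spec_norm H + \<mu>)"
    and d: "(H + \<mu> *\<^sub>R mat 1) *v d = (C - mat 1) *v g"
  shows "d \<bullet> g \<le> - ((1 - b) / (spec_norm H + \<mu>) * (norm g)\<^sup>2)"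
    and "norm d \<le> (1 + b) / \<mu> * norm g"
proof -
  define h where "h = spec_norm H"
  have h: "0 \<le> h" by (simp add: h_def spec_norm_nonneg)
  have C': "spec_norm C \<le> b * \<mu> / (h + \<mu>)" using C by (simp add: h_def)
  have "b * \<mu> \<le> b * (h + \<mu>)" using b h by (intro mult_left_mono) auto
  then have "b * \<mu> / (h + \<mu>) \<le> b" using h \<mu> by (simp add: field_simps)
  then have "spec_norm C \<le> b" using C' by linarith
  then have Cg: "norm (C *v g) \<le> b * norm g"
    by (intro order_trans[OF norm_matrix_vector_le] mult_right_mono) auto
  define A where "A = H + \<mu> *\<^sub>R mat 1"
  have A: "A *v y = H *v y + \<mu> *\<^sub>R y" for y
    by (simp add: A_def matrix_vector_mult_add_rdistrib scaleR_matrix_vector_assoc[symmetric])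
  have A_sym: "transpose A = A"
    using sym by (simp add: A_def transpose_def vec_eq_iff mat_def eq_commute)
  have A_ge: "\<mu> * (norm y)\<^sup>2 \<le> y \<bullet> (A *v y)" for y
    using psd[of y] by (simp add: A inner_add_right power2_norm_eq_inner)
  have A_norm_ge: "\<mu> * norm y \<le> norm (A *v y)" for y
  proof -
    have "(\<mu> * norm y) * norm y \<le> norm (A *v y) * norm y"
      using A_ge[of y] norm_cauchy_schwarz[of y "A *v y"] by (simp add: power2_eq_square mult_ac)
    then show ?thesis by (cases "y = 0") (auto simp: mult_le_cancel_right)
  qed
  have A_bound: "norm (A *v y) \<le> (h + \<mu>) * norm y" for y
    using norm_triangle_ineq[of "H *v y" "\<mu> *\<^sub>R y"] norm_matrix_vector_le[of H y] \<mu>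
    by (simp add: A h_def algebra_simps)
  have Ad: "A *v d = C *v g - g"
    using d by (simp add: A_def matrix_vector_mult_diff_rdistrib)
  have "\<mu> * norm d \<le> (1 + b) * norm g"
    using A_norm_ge[of d] norm_triangle_ineq4[of "C *v g" g] Cg by (simp add: Ad algebra_simps)
  then show "norm d \<le> (1 + b) / \<mu> * norm g"
    using \<mu> by (simp add: field_simps)
  \<comment> \<open>Coercivity gives injectivity and finite dimension surjectivity, so
    \<open>y\<close> can stand for the inverse of \<open>A\<close> applied to
    \<open>g\<close>.\<close>
  have "inj ((*v) A)"
  proof (rule injI)
    fix y y' assume "A *v y = A *v y'"
    then have "\<mu> * norm (y - y') \<le> 0"
      using A_norm_ge[of "y - y'"] by (simp add: matrix_vector_mult_diff_distrib)
    then show "y = y'" using \<mu> by (simp add: mult_le_0_iff)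
  qed
  then have "surj ((*v) A)"
    by (intro linear_inj_imp_surj matrix_vector_mul_linear)
  then obtain y where y: "A *v y = g" by (metis surjD)
  have "(norm g)\<^sup>2 \<le> (h + \<mu>) * (y \<bullet> g)"
    using psd_norm_squared_le[OF A_sym _ A_bound, of y] h \<mu> order_trans[OF _ A_ge]
    by (simp add: y)
  then have yg: "(norm g)\<^sup>2 / (h + \<mu>) \<le> y \<bullet> g"
    using h \<mu> by (simp add: field_simps)
  have "norm y \<le> norm g / \<mu>"
    using A_norm_ge[of y] \<mu> by (simp add: y field_simps)
  then have "(C *v g) \<bullet> y \<le> (b * \<mu> / (h + \<mu>) * norm g) * (norm g / \<mu>)"
    using order_trans[OF norm_matrix_vector_le mult_right_mono[OF C' norm_ge_zero]] b h \<mu>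
    by (intro order_trans[OF norm_cauchy_schwarz] mult_mono) auto
  also have "\<dots> = b * ((norm g)\<^sup>2 / (h + \<mu>))"
    using \<mu> h by (simp add: field_simps power2_eq_square)
  finally have Cgy: "(C *v g) \<bullet> y \<le> b * ((norm g)\<^sup>2 / (h + \<mu>))" .
  have "d \<bullet> g = (A *v d) \<bullet> y"
    using inner_transpose[of A d y] by (simp add: A_sym y)
  also have "\<dots> = (C *v g) \<bullet> y - y \<bullet> g"
    by (simp only: Ad inner_diff_left inner_commute[of g y])
  also have "\<dots> \<le> b * ((norm g)\<^sup>2 / (h + \<mu>)) - (norm g)\<^sup>2 / (h + \<mu>)"
    using Cgy yg by simp
  also have "\<dots> = - ((1 - b) / (h + \<mu>) * (norm g)\<^sup>2)"
    by (simp add: field_simps diff_divide_distrib)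
  finally show "d \<bullet> g \<le> - ((1 - b) / (spec_norm H + \<mu>) * (norm g)\<^sup>2)"
    by (simp add: h_def)
qed

lemma transpose_block_diag: "transpose A = A \<Longrightarrow> transpose (block_diag P A) = block_diag P A"
  by (auto simp: block_diag_def transpose_def vec_eq_iff)

text \<open>The values of the form of \<open>A\<close> at the restrictions \<open>w I\<close> of
  \<open>y\<close> to the blocks add up to the form of the block diagonal part.\<close>

lemma block_diag_psd:
  fixes A :: "real^'n^'n"
  assumes P: "partition_on UNIV P" and psd: "\<And>y. 0 \<le> y \<bullet> (A *v y)"
  shows "0 \<le> y \<bullet> (block_diag P A *v y)"
proof -
  define w where "w I = (\<chi> i. if i \<in> I then y $ i else 0)" for I
  have fin: "finite P" using finite_elements[OF _ P] by simp
  have entry: "y $ i * (block_diag P A $ i $ j * y $ j) = (\<Sum>I\<in>P. w I $ i * (A $ i $ j * w I $ j))" for i j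
  proof -
    have "i \<in> \<Union>P" using P by (simp add: partition_on_def)
    then obtain I where I: "I \<in> P" "i \<in> I" by blast
    have uniq: "I' = I" if "I' \<in> P" "i \<in> I'" for I'
      using that I P by (auto simp: partition_on_def disjoint_def)
    \<comment> \<open>Every index lies in exactly one block, so only the block containing
      \<open>i\<close> contributes.\<close>
    have "(\<Sum>I\<in>P. w I $ i * (A $ i $ j * w I $ j)) = (\<Sum>I'\<in>{I}. w I' $ i * (A $ i $ j * w I' $ j))"
    proof (rule sum.mono_neutral_right)
      show "\<forall>I'\<in>P - {I}. w I' $ i * (A $ i $ j * w I' $ j) = 0"
      proof
        fix I' assume "I' \<in> P - {I}"
        then have "i \<notin> I'" using uniq[of I'] by blast
        then show "w I' $ i * (A $ i $ j * w I' $ j) = 0" by (simp add: w_def)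
      qed
    qed (use fin I in simp_all)
    moreover have "(\<exists>I'\<in>P. i \<in> I' \<and> j \<in> I') \<longleftrightarrow> j \<in> I"
      using I uniq by metis
    ultimately show ?thesis using I by (simp add: w_def block_diag_def)
  qed
  have "y \<bullet> (block_diag P A *v y) = (\<Sum>i\<in>UNIV. \<Sum>j\<in>UNIV. y $ i * (block_diag P A $ i $ j * y $ j))"
    by (simp add: inner_vec_def matrix_vector_mult_def sum_distrib_left)
  also have "\<dots> = (\<Sum>i\<in>UNIV. \<Sum>I\<in>P. \<Sum>j\<in>UNIV. w I $ i * (A $ i $ j * w I $ j))"
    unfolding entry by (intro sum.cong refl sum.swap)
  also have "\<dots> = (\<Sum>I\<in>P. \<Sum>i\<in>UNIV. \<Sum>j\<in>UNIV. w I $ i * (A $ i $ j * w I $ j))"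
    by (rule sum.swap)
  also have "\<dots> = (\<Sum>I\<in>P. w I \<bullet> (A *v w I))"
    by (simp add: inner_vec_def matrix_vector_mult_def sum_distrib_left)
  finally show ?thesis by (simp add: sum_nonneg psd)
qed

lemma transpose_gram: "transpose (gram R x) = gram R x"
  by (simp add: gram_def matrix_transpose_mul)

lemma gram_inner: "y \<bullet> (gram R x *v z) = (Jac R x *v y) \<bullet> (Jac R x *v z)"
  by (metis gram_vector inner_transpose inner_commute)

section \<open>Parameters of the algorithm\<close>

text \<open>Positivity makes \<open>1 / \<gamma>\<close> a genuine cap on the step size, as division
  by zero would give 0; the upper bound keeps this cap away from zero.\<close>

lemma lms_gamma_bounds:
  fixes R :: "real^'n \<Rightarrow> real^'m"
  assumes "spec_norm (\<beta> *\<^sub>R Bmat R P x) \<le> b" "b < 1"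
  shows "0 < lms_gamma R P \<beta> x" and "lms_gamma R P \<beta> x \<le> 1 + b"
proof -
  define C where "C = \<beta> *\<^sub>R Bmat R P x"
  have C: "norm (C *v v) \<le> b * norm v" for v
    using assms(1) by (intro order_trans[OF norm_matrix_vector_le] mult_right_mono) (auto simp: C_def)
  have eq: "(mat 1 - C) *v v = v - C *v v" for v
    by (simp add: matrix_vector_mult_diff_rdistrib)
  show "lms_gamma R P \<beta> x \<le> 1 + b"
    unfolding lms_gamma_def C_def[symmetric] spec_norm_def
  proof (rule onorm_le)
    fix v show "norm ((mat 1 - C) *v v) \<le> (1 + b) * norm v"
      using norm_triangle_ineq4[of v "C *v v"] C[of v] by (simp add: eq algebra_simps)
  qed
  define v :: "real^'n" where "v = (\<chi> i. 1)"
  have v: "0 < norm v" by (simp add: v_def vec_eq_iff)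
  have "(1 - b) * norm v \<le> norm ((mat 1 - C) *v v)"
    using norm_triangle_ineq2[of v "C *v v"] C[of v] by (simp add: eq algebra_simps)
  also have "\<dots> \<le> lms_gamma R P \<beta> x * norm v"
    unfolding lms_gamma_def C_def[symmetric] by (rule norm_matrix_vector_le)
  finally have "1 - b \<le> lms_gamma R P \<beta> x" using v by simp
  then show "0 < lms_gamma R P \<beta> x" using assms(2) by linarith
qed

lemma lms_mu_ge_1:
  assumes "0 \<le> l" "b < 1"
  shows "1 \<le> lms_mu R P b l x"
proof -
  let ?a = "\<lambda>a0 a1 a2 a3. Max {a0, a1, a2, a3 :: real}"
  have "0 \<le> (spec_norm (Jac R x))\<^sup>2 + l * norm (R x)" using assms by simp
  also have "\<dots> \<le> ?a a0 a1 a2 \<dots>" for a0 a1 a2 by (intro Max_ge) auto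
  finally show ?thesis
    unfolding lms_mu_def Let_def using assms by simp
qed

lemma lms_sequence_l_nonneg:
  assumes lms: "lms_sequence R P c b \<eta>hat lmin x l \<beta> d t" and "0 \<le> l 0" "0 \<le> lmin"
  shows "0 \<le> l k"
proof (induction k)
  case (Suc k)
  have "l (Suc k) \<in> {2 * l k, max lmin (l k / 2), l k}"
    using lms unfolding lms_sequence_def Let_def by (auto split: if_splits)
  then show ?case using Suc assms by auto
qed (use assms in simp)

section \<open>Geometry of the stationary set near a solution\<close>

text \<open>Collects what concerns \<open>R\<close> alone, apart from the algorithm. In the theorem
  \<open>a\<close> becomes \<open>xstar\<close> and \<open>K\<close> becomes
  \<open>L2\<close>.\<close>

locale local_regularity =
  fixes R :: "real^'n \<Rightarrow> real^'m" and a :: "real^'n" and r L \<omega> \<sigma> K :: real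
  assumes cont_diff: "cont_diff R"
    and stationary_center: "a \<in> stationary R"
    and \<omega>_pos: "0 < \<omega>"
    and K_pos: "0 < K"
    and Jac_lipschitz: "spec_norm (Jac R x - Jac R y) \<le> L * norm (x - y)"
    and error_bound: "x \<in> ball a r \<Longrightarrow> \<omega> * infdist x (stationary R) \<le> norm (grad R x)"
    and residual_bound: "x \<in> ball a r \<Longrightarrow> z \<in> ball a r \<Longrightarrow> z \<in> stationary R \<Longrightarrow>
      norm (transpose (Jac R x - Jac R z) *v R z) \<le> \<sigma> * norm (x - z)"
    and R_lipschitz: "x \<in> ball a r \<Longrightarrow> y \<in> ball a r \<Longrightarrow> norm (R x - R y) \<le> K * norm (x - y)"
begin

abbreviation "S \<equiv> stationary R"

abbreviation "\<delta> x \<equiv> infdist x S"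

lemma L_nonneg: "0 \<le> L"
proof -
  have "0 \<le> L * norm ((\<chi> i. 1) - 0 :: real^'n)"
    by (rule order_trans[OF spec_norm_nonneg Jac_lipschitz])
  moreover have "0 < norm ((\<chi> i. 1) - 0 :: real^'n)"
    by (simp add: vec_eq_iff)
  ultimately show ?thesis by (simp add: zero_le_mult_iff)
qed

lemma norm_Jac_diff_transpose_le:
  "norm (transpose (Jac R x - Jac R y) *v v) \<le> L * norm (x - y) * norm v"
  by (rule order_trans[OF norm_transpose_vector_le mult_right_mono[OF Jac_lipschitz]]) simp

lemma Taylor: "norm (R (z + v) - R z - Jac R z *v v) \<le> L / 2 * (norm v)\<^sup>2"
  by (rule norm_Taylor_remainder_le[OF cont_diff Jac_lipschitz])

text \<open>The Lipschitz bound controls difference quotients over short segments, and the Taylor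
  remainder is quadratic in their length.\<close>

lemma norm_Jac_vector_le:
  assumes x: "x \<in> ball a r"
  shows "norm (Jac R x *v v) \<le> K * norm v"
proof -
  obtain s0 where s0: "0 < s0" "\<And>s. 0 < s \<Longrightarrow> s < s0 \<Longrightarrow> x + s *\<^sub>R v \<in> ball a r"
    using small_step_in_ball[OF x] by blast
  show ?thesis
  proof (rule le_if_le_up_to_square[OF s0(1), of _ _ "L / 2 * (norm v)\<^sup>2"])
    fix s assume s: "0 < s" "s < s0"
    have "s * norm (Jac R x *v v) = norm (Jac R x *v (s *\<^sub>R v))"
      using s(1) by (simp add: matrix_vector_mult_scaleR)
    also have "\<dots> \<le> norm (R (x + s *\<^sub>R v) - R x)
        + norm (R (x + s *\<^sub>R v) - R x - Jac R x *v (s *\<^sub>R v))"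
      by (metis norm_triangle_sub norm_minus_commute)
    also have "\<dots> \<le> K * norm (s *\<^sub>R v) + L / 2 * (norm (s *\<^sub>R v))\<^sup>2"
      using R_lipschitz[OF s0(2)[OF s] x] Taylor[of x "s *\<^sub>R v"] by simp
    finally show "s * norm (Jac R x *v v) \<le> s * (K * norm v) + L / 2 * (norm v)\<^sup>2 * s\<^sup>2"
      using s(1) by (simp add: power_mult_distrib mult_ac)
  qed
qed

lemma norm_Jac_transpose_le:
  "x \<in> ball a r \<Longrightarrow> norm (transpose (Jac R x) *v v) \<le> K * norm v"
  by (rule norm_transpose_vector_le_bound[OF norm_Jac_vector_le])

text \<open>As the gradient vanishes at \<open>z\<close>, the error has three parts: a Taylor
  remainder and a product of the changes of Jacobian and residual, both quadratic, and the change of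
  the Jacobian applied to \<open>R z\<close>, which the residual condition controls.\<close>

lemma norm_grad_minus_gram_le:
  assumes z: "z \<in> ball a r" "z \<in> S" and y: "z + v \<in> ball a r"
  shows "norm (grad R (z + v) - gram R z *v v) \<le> \<sigma> * norm v + 3 / 2 * L * K * (norm v)\<^sup>2"
proof -
  let ?T = "R (z + v) - R z - Jac R z *v v"
  let ?D = "transpose (Jac R (z + v) - Jac R z)"
  have "norm (transpose (Jac R z) *v ?T) \<le> K * norm ?T"
    by (rule norm_Jac_transpose_le[OF z(1)])
  also have "\<dots> \<le> K * (L / 2 * (norm v)\<^sup>2)"
    using K_pos Taylor by (intro mult_left_mono) auto
  finally have 1: "norm (transpose (Jac R z) *v ?T) \<le> K * (L / 2 * (norm v)\<^sup>2)" .
  have "norm (?D *v (R (z + v) - R z)) \<le> L * norm v * norm (R (z + v) - R z)"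
    using norm_Jac_diff_transpose_le[of "z + v" z] by simp
  also have "\<dots> \<le> L * norm v * (K * norm v)"
    using R_lipschitz[OF y z(1)] L_nonneg by (intro mult_left_mono) auto
  finally have 2: "norm (?D *v (R (z + v) - R z)) \<le> L * norm v * (K * norm v)" .
  have 3: "norm (?D *v R z) \<le> \<sigma> * norm v"
    using residual_bound[OF y z] by simp
  have "transpose (Jac R z) *v R z = 0"
    using z by (simp add: stationary_def)
  then have eq: "grad R (z + v) - gram R z *v v
      = transpose (Jac R z) *v ?T + ?D *v (R (z + v) - R z) + ?D *v R z"
    by (simp add: grad_def gram_vector transpose_diff matrix_vector_mult_diff_rdistrib
        matrix_vector_mult_diff_distrib matrix_vector_right_distrib)
  have "norm (grad R (z + v) - gram R z *v v) \<le> norm (transpose (Jac R z) *v ?T)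
      + norm (?D *v (R (z + v) - R z)) + norm (?D *v R z)"
    unfolding eq by (rule norm_triangle_le, rule add_mono[OF norm_triangle_ineq order_refl])
  also have "\<dots> \<le> K * (L / 2 * (norm v)\<^sup>2) + L * norm v * (K * norm v) + \<sigma> * norm v"
    using 1 2 3 by linarith
  finally show ?thesis by (simp add: power2_eq_square algebra_simps)
qed

text \<open>With \<open>u = y - z\<close>, the point \<open>z + s *\<^sub>R v\<close> has distance
  at least \<open>norm u - norm (u - s *\<^sub>R v)\<close> to \<open>S\<close>, which is
  \<open>s * (u \<bullet> v) / norm u\<close> to first order. The error bound transfers this to the
  gradient there, whose size is estimated by \<open>norm_grad_minus_gram_le\<close>.\<close>

lemma normal_direction_bound:
  assumes z: "z \<in> ball a r" "z \<in> S" and y: "\<delta> y = norm (y - z)"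
  shows "\<omega> * ((y - z) \<bullet> v) \<le> norm (y - z) * (norm (gram R z *v v) + \<sigma> * norm v)"
proof (cases "y = z")
  case True
  then show ?thesis by simp
next
  case False
  define u where "u = y - z"
  have u: "0 < norm u" using False by (simp add: u_def)
  obtain s0 where s0: "0 < s0" "\<And>s. 0 < s \<Longrightarrow> s < s0 \<Longrightarrow> z + s *\<^sub>R v \<in> ball a r"
    using small_step_in_ball[OF z(1)] by blast
  define C where "C = norm u * (3 / 2 * L * K * (norm v)\<^sup>2) + \<omega> * (norm v)\<^sup>2 / 2"
  show ?thesis
    unfolding u_def[symmetric]
  proof (rule le_if_le_up_to_square[OF s0(1), of _ _ C])
    fix s assume s: "0 < s" "s < s0"
    have zs: "z + s *\<^sub>R v \<in> ball a r" using s0(2)[OF s] .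
    have "norm (grad R (z + s *\<^sub>R v))
        \<le> norm (gram R z *v (s *\<^sub>R v)) + norm (grad R (z + s *\<^sub>R v) - gram R z *v (s *\<^sub>R v))"
      by (rule norm_triangle_sub)
    also have "\<dots> \<le> s * norm (gram R z *v v)
        + (\<sigma> * norm (s *\<^sub>R v) + 3 / 2 * L * K * (norm (s *\<^sub>R v))\<^sup>2)"
      using norm_grad_minus_gram_le[OF z zs] s(1) by (simp add: matrix_vector_mult_scaleR)
    finally have g: "norm (grad R (z + s *\<^sub>R v))
        \<le> s * (norm (gram R z *v v) + \<sigma> * norm v) + 3 / 2 * L * K * (norm v)\<^sup>2 * s\<^sup>2"
      using s(1) by (simp add: power_mult_distrib algebra_simps)
    have "norm u \<le> \<delta> (z + s *\<^sub>R v) + dist y (z + s *\<^sub>R v)"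
      using infdist_triangle[of y S "z + s *\<^sub>R v"] y by (simp add: u_def)
    then have 1: "norm u \<le> \<delta> (z + s *\<^sub>R v) + norm (u - s *\<^sub>R v)"
      by (simp add: dist_norm u_def algebra_simps)
    \<comment> \<open>This replaces a norm by its square, which expands exactly; the loss is only of
      order \<open>s\<^sup>2\<close>.\<close>
    have "2 * norm u * norm (u - s *\<^sub>R v) \<le> (norm u)\<^sup>2 + (norm (u - s *\<^sub>R v))\<^sup>2"
      using zero_le_power2[of "norm u - norm (u - s *\<^sub>R v)"] by (simp add: power2_diff)
    also have "\<dots> = 2 * (norm u)\<^sup>2 - 2 * s * (u \<bullet> v) + s\<^sup>2 * (norm v)\<^sup>2"
      using norm_add_scaleR_squared[of u "-s" v] by simp
    finally have 2: "norm u * norm (u - s *\<^sub>R v)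
        \<le> (norm u)\<^sup>2 - s * (u \<bullet> v) + s\<^sup>2 * (norm v)\<^sup>2 / 2" by simp
    have "(norm u)\<^sup>2 \<le> norm u * \<delta> (z + s *\<^sub>R v) + norm u * norm (u - s *\<^sub>R v)"
      using mult_left_mono[OF 1, of "norm u"] by (simp add: power2_eq_square algebra_simps)
    then have "s * (u \<bullet> v) \<le> norm u * \<delta> (z + s *\<^sub>R v) + s\<^sup>2 * (norm v)\<^sup>2 / 2"
      using 2 by simp
    from mult_left_mono[OF this, of \<omega>]
    have "\<omega> * (s * (u \<bullet> v)) \<le> norm u * (\<omega> * \<delta> (z + s *\<^sub>R v)) + \<omega> * (s\<^sup>2 * (norm v)\<^sup>2 / 2)"
      using \<omega>_pos by (simp add: algebra_simps)
    also have "norm u * (\<omega> * \<delta> (z + s *\<^sub>R v))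
        \<le> norm u * (s * (norm (gram R z *v v) + \<sigma> * norm v) + 3 / 2 * L * K * (norm v)\<^sup>2 * s\<^sup>2)"
      by (intro mult_left_mono order_trans[OF error_bound[OF zs] g]) simp
    finally show "s * (\<omega> * (u \<bullet> v))
        \<le> s * (norm u * (norm (gram R z *v v) + \<sigma> * norm v)) + C * s\<^sup>2"
      by (simp add: C_def algebra_simps)
  qed
qed

text \<open>The center is itself stationary, so a nearest point is at most twice as far from
  \<open>a\<close> as \<open>y\<close> is; this is the origin of the radius
  \<open>r / 2\<close>.\<close>

lemma nearest_stationary:
  assumes "norm (y - a) < r / 2"
  obtains z where "z \<in> ball a r" "z \<in> S" "\<delta> y = norm (y - z)"
proof -
  have "S \<noteq> {}" using stationary_center by blast
  then obtain z where z: "z \<in> S" "\<delta> y = dist y z"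
    using infdist_attains_inf[OF closed_stationary[OF cont_diff], of y] by blast
  have "dist y z \<le> dist y a"
    using infdist_le[OF stationary_center, of y] z by simp
  then have "dist a z < r"
    using assms dist_triangle[of a z y] by (simp add: dist_norm norm_minus_commute)
  then show ?thesis using that z by (simp add: dist_norm)
qed

section \<open>Distance to the stationary set along one step\<close>

text \<open>Both \<open>gram R z *v (x + d - z)\<close> and \<open>grad R x + gram R x *v d\<close>
  approximate a transposed Jacobian applied to \<open>R (x + d)\<close>, taken at \<open>z\<close>
  and at \<open>x\<close> respectively. They differ by two Taylor remainders and the change of the
  Jacobian from \<open>x\<close> to \<open>z\<close>, split at \<open>R z\<close>.\<close>

lemma norm_gram_vector_step_le:
  assumes x: "x \<in> ball a r" and w: "x + d \<in> ball a r" and z: "z \<in> ball a r" "z \<in> S"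
  shows "norm (gram R z *v (x + d - z)) \<le> norm (grad R x + gram R x *v d) + \<sigma> * norm (x - z)
    + L * K * ((norm d)\<^sup>2 / 2 + (norm (x + d - z))\<^sup>2 / 2 + norm (x - z) * norm (x + d - z))"
proof -
  define v where "v = x + d - z"
  let ?T = "R (x + d) - R x - Jac R x *v d"
  let ?T' = "R (z + v) - R z - Jac R z *v v"
  let ?D = "transpose (Jac R x - Jac R z)"
  have zv: "z + v = x + d" by (simp add: v_def)
  have "norm (transpose (Jac R x) *v ?T) \<le> K * norm ?T"
    by (rule norm_Jac_transpose_le[OF x])
  also have "\<dots> \<le> K * (L / 2 * (norm d)\<^sup>2)"
    using K_pos Taylor by (intro mult_left_mono) auto
  finally have 1: "norm (transpose (Jac R x) *v ?T) \<le> K * (L / 2 * (norm d)\<^sup>2)" .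
  have "norm (transpose (Jac R z) *v ?T') \<le> K * norm ?T'"
    by (rule norm_Jac_transpose_le[OF z(1)])
  also have "\<dots> \<le> K * (L / 2 * (norm v)\<^sup>2)"
    using K_pos Taylor by (intro mult_left_mono) auto
  finally have 2: "norm (transpose (Jac R z) *v ?T') \<le> K * (L / 2 * (norm v)\<^sup>2)" .
  have "norm (?D *v (R (x + d) - R z)) \<le> L * norm (x - z) * norm (R (x + d) - R z)"
    by (rule norm_Jac_diff_transpose_le)
  also have "\<dots> \<le> L * norm (x - z) * (K * norm v)"
    using R_lipschitz[OF w z(1)] L_nonneg by (intro mult_left_mono) (auto simp: v_def)
  finally have 3: "norm (?D *v (R (x + d) - R z)) \<le> L * norm (x - z) * (K * norm v)" .
  have 4: "norm (?D *v R z) \<le> \<sigma> * norm (x - z)"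
    using residual_bound[OF x z] by simp
  have "transpose (Jac R z) *v R z = 0"
    using z by (simp add: stationary_def)
  then have eq: "gram R z *v v = (grad R x + gram R x *v d) + transpose (Jac R x) *v ?T
      - ?D *v (R (x + d) - R z) - ?D *v R z - transpose (Jac R z) *v ?T'"
    unfolding zv
    by (simp add: grad_def gram_vector transpose_diff matrix_vector_mult_diff_rdistrib
        matrix_vector_mult_diff_distrib matrix_vector_right_distrib)
  have "norm (gram R z *v v) \<le> norm (grad R x + gram R x *v d) + norm (transpose (Jac R x) *v ?T)
      + norm (?D *v (R (x + d) - R z)) + norm (?D *v R z) + norm (transpose (Jac R z) *v ?T')"
    unfolding eq
    by (intro order_trans[OF norm_triangle_ineq4] order_trans[OF norm_triangle_ineq] add_mono order_refl)
  also have "\<dots> \<le> norm (grad R x + gram R x *v d) + K * (L / 2 * (norm d)\<^sup>2)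
      + L * norm (x - z) * (K * norm v) + \<sigma> * norm (x - z) + K * (L / 2 * (norm v)\<^sup>2)"
    using 1 2 3 4 by linarith
  finally show ?thesis by (simp add: v_def algebra_simps)
qed

text \<open>Instance of \<open>normal_direction_bound\<close> at \<open>x + t *\<^sub>R d\<close>
  with \<open>v = x + d - z\<close>. As \<open>v\<close> is \<open>x + t *\<^sub>R d - z\<close>
  plus \<open>(1 - t) *\<^sub>R d\<close>, it constrains the slope of the distance along
  \<open>d\<close>.\<close>

lemma inner_step_le:
  assumes near: "norm (x - a) + norm d < r / 2"
    and "0 \<le> c" "0 \<le> \<sigma>" and d: "norm d \<le> c * \<delta> x"
    and model: "norm (grad R x + gram R x *v d) \<le> M * \<delta> x"
    and small: "M + (2 + c) * \<sigma> + L * K * ((1 + c) * (2 + c)) * \<delta> x \<le> \<eta> * \<omega>"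
    and t: "0 \<le> t" "t \<le> 1" and le: "\<delta> (x + t *\<^sub>R d) \<le> \<delta> x"
    and z: "z \<in> ball a r" "z \<in> S" "\<delta> (x + t *\<^sub>R d) = norm (x + t *\<^sub>R d - z)"
  shows "(x + t *\<^sub>R d - z) \<bullet> (x + d - z) \<le> norm (x + t *\<^sub>R d - z) * (\<eta> * \<delta> x)"
proof -
  define u v where "u = x + t *\<^sub>R d - z" and "v = x + d - z"
  define e where "e = \<delta> x"
  have e: "0 \<le> e" by (simp add: e_def infdist_nonneg)
  have u: "norm u \<le> e" using le z by (simp add: u_def e_def)
  have "norm (x + d - a) \<le> norm (x - a) + norm d"
    using norm_triangle_ineq[of "x - a" d] by (simp add: algebra_simps)
  then have w: "x + d \<in> ball a r" and x: "x \<in> ball a r"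
    using near norm_ge_zero[of d] norm_ge_zero[of "x - a"]
    by (auto simp: dist_norm norm_minus_commute simp del: norm_ge_zero)
  have "x - z = u - t *\<^sub>R d" "v = u + (1 - t) *\<^sub>R d"
    by (simp_all add: u_def v_def algebra_simps)
  then have xz: "norm (x - z) \<le> norm u + t * norm d" and v: "norm v \<le> norm u + (1 - t) * norm d"
    using norm_triangle_ineq4[of u "t *\<^sub>R d"] norm_triangle_ineq[of u "(1 - t) *\<^sub>R d"] t by auto
  \<comment> \<open>The shares \<open>t\<close> and \<open>1 - t\<close> of \<open>norm d\<close>
    add up to one, which gives \<open>2 + c\<close> for every \<open>t\<close>.\<close>
  have sum: "norm (x - z) + norm v \<le> (2 + c) * e"
    using xz v u d by (simp add: algebra_simps e_def)
  have "(1 - t) * norm d \<le> 1 * norm d" using t by (intro mult_right_mono) auto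
  then have v': "norm v \<le> (1 + c) * e"
    using v u d by (simp add: algebra_simps e_def)
  have "norm (x - z) * norm v \<le> ((2 + c) * e - norm v) * norm v"
    using sum by (intro mult_right_mono) auto
  \<comment> \<open>With \<open>P = (2 + c) * e\<close>, \<open>Q = (1 + c) * e\<close> and
    \<open>n = norm v\<close>, the expression \<open>2 * P * n - n\<^sup>2\<close> increases up to
    \<open>n = P\<close>, so \<open>n \<le> Q\<close> bounds it by
    \<open>2 * P * Q - Q\<^sup>2\<close>. The product is this fact in factored form;
    \<open>norm d \<le> Q\<close> then compensates \<open>- Q\<^sup>2\<close>.\<close>
  moreover have "0 \<le> ((1 + c) * e - norm v) * (2 * ((2 + c) * e) - ((1 + c) * e + norm v))"
    using v' e by (intro mult_nonneg_nonneg) (auto simp: algebra_simps)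
  moreover have "(norm d)\<^sup>2 \<le> ((1 + c) * e)\<^sup>2"
    using d e by (intro power_mono) (auto simp: e_def algebra_simps)
  ultimately have "(norm d)\<^sup>2 + (norm v)\<^sup>2 + 2 * (norm (x - z) * norm v)
      \<le> 2 * ((1 + c) * (2 + c) * e\<^sup>2)"
    by (simp add: power2_eq_square algebra_simps)
  then have quad: "(norm d)\<^sup>2 / 2 + (norm v)\<^sup>2 / 2 + norm (x - z) * norm v
      \<le> (1 + c) * (2 + c) * e\<^sup>2" by linarith
  have "norm (gram R z *v v) + \<sigma> * norm v \<le> M * e + \<sigma> * (norm (x - z) + norm v)
      + L * K * ((norm d)\<^sup>2 / 2 + (norm v)\<^sup>2 / 2 + norm (x - z) * norm v)"
    using norm_gram_vector_step_le[OF x w z(1,2)] model by (simp add: v_def e_def algebra_simps)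
  also have "\<dots> \<le> M * e + \<sigma> * ((2 + c) * e) + L * K * ((1 + c) * (2 + c) * e\<^sup>2)"
    using quad sum \<open>0 \<le> \<sigma>\<close> L_nonneg K_pos
    by (intro add_mono[OF add_mono[OF order_refl]] mult_left_mono) auto
  also have "\<dots> = (M + (2 + c) * \<sigma> + L * K * ((1 + c) * (2 + c)) * e) * e"
    by (simp add: power2_eq_square algebra_simps)
  also have "\<dots> \<le> \<eta> * \<omega> * e"
    using small e by (intro mult_right_mono) (auto simp: e_def)
  finally have "norm u * (norm (gram R z *v v) + \<sigma> * norm v) \<le> norm u * (\<eta> * \<omega> * e)"
    by (rule mult_left_mono) simp
  then have "\<omega> * (u \<bullet> v) \<le> \<omega> * (norm u * (\<eta> * e))"
    using normal_direction_bound[OF z, of v] by (simp add: u_def mult_ac)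
  then show ?thesis
    using \<omega>_pos by (simp add: u_def v_def e_def)
qed

text \<open>The distance to \<open>S\<close> along the step has slope at most \<open>- (1 - \<eta>) * \<delta> x\<close> at any parameter
  where it reaches a line of slope \<open>- (1 - \<eta>) * \<delta> x + \<kappa>\<close> from below, so it cannot cross that line.\<close>

lemma infdist_step_le:
  assumes near: "norm (x - a) + norm d < r / 2"
    and c: "0 \<le> c" and \<sigma>: "0 \<le> \<sigma>" and d: "norm d \<le> c * \<delta> x"
    and model: "norm (grad R x + gram R x *v d) \<le> M * \<delta> x"
    and small: "M + (2 + c) * \<sigma> + L * K * ((1 + c) * (2 + c)) * \<delta> x \<le> \<eta> * \<omega>"
    and \<eta>: "0 < \<eta>" "\<eta> < 1" and t: "0 \<le> t" "t \<le> 1"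
  shows "\<delta> (x + t *\<^sub>R d) \<le> (1 - t * (1 - \<eta>)) * \<delta> x"
proof (cases "\<delta> x = 0")
  case True
  then show ?thesis using d by simp
next
  case False
  define e m where "e = \<delta> x" and "m = (1 - \<eta>) * e"
  have e: "0 < e" using False infdist_nonneg[of x S] by (simp add: e_def)
  have m: "0 < m" "m < e" using e \<eta> by (auto simp: m_def)
  \<comment> \<open>The slack \<open>\<kappa>\<close> makes the comparison of slopes strict; it
    tends to 0 at the end.\<close>
  have *: "\<delta> (x + t *\<^sub>R d) \<le> e - t * (m - \<kappa>)" if \<kappa>: "0 < \<kappa>" "\<kappa> < m" for \<kappa>
  proof (rule ccontr)
    assume neg: "\<not> ?thesis"
    define \<theta> where "\<theta> s = \<delta> (x + s *\<^sub>R d) - e + s * (m - \<kappa>)" for s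
    have \<theta>t: "0 < \<theta> t" using neg by (simp add: \<theta>_def)
    have cont: "continuous_on A \<theta>" for A
      unfolding \<theta>_def by (intro continuous_intros)
    have "compact ({0..t} \<inter> {s. \<theta> s \<le> 0})"
      by (intro compact_Int_closed closed_Collect_le cont continuous_on_const) auto
    moreover have "0 \<in> {0..t} \<inter> {s. \<theta> s \<le> 0}"
      using t by (simp add: \<theta>_def e_def)
    \<comment> \<open>This is the last parameter at which the line is not exceeded; the intermediate
      value theorem then forces equality there.\<close>
    ultimately obtain s where "s \<in> {0..t} \<inter> {s. \<theta> s \<le> 0}"
      and "\<forall>s' \<in> {0..t} \<inter> {s. \<theta> s \<le> 0}. s' \<le> s"
      by (metis compact_attains_sup empty_iff)
    then have s: "0 \<le> s" "s \<le> t" "\<theta> s \<le> 0"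
      and max: "\<And>s'. 0 \<le> s' \<Longrightarrow> s' \<le> t \<Longrightarrow> \<theta> s' \<le> 0 \<Longrightarrow> s' \<le> s"
      by auto
    obtain s' where "s \<le> s'" "s' \<le> t" "\<theta> s' = 0"
      using IVT'[of \<theta> s 0 t] s \<theta>t cont by auto
    then have \<theta>s: "\<theta> s = 0" using max[of s'] s by auto
    have st: "s < t" using \<theta>s \<theta>t s by (cases "s = t") auto
    define D where "D = \<delta> (x + s *\<^sub>R d)"
    have D: "D = e - s * (m - \<kappa>)" using \<theta>s by (simp add: \<theta>_def D_def)
    have D_le: "D \<le> e" using D s \<kappa> by simp
    have D_ge: "\<eta> * e + (1 - s) * m \<le> D"
      using D s \<kappa> by (simp add: m_def algebra_simps)
    have "0 < \<eta> * e + (1 - s) * m"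
      using \<eta> e s st t m by (intro add_pos_nonneg) auto
    then have D_pos: "0 < D" using D_ge by simp
    have "norm (x + s *\<^sub>R d - a) \<le> norm (x - a) + s * norm d"
      using norm_triangle_ineq[of "x - a" "s *\<^sub>R d"] s by (simp add: algebra_simps)
    also have "\<dots> \<le> norm (x - a) + 1 * norm d"
      using st t by (intro add_mono mult_right_mono) auto
    also have "\<dots> < r / 2" using near by simp
    finally obtain z where z: "z \<in> ball a r" "z \<in> S" "\<delta> (x + s *\<^sub>R d) = norm (x + s *\<^sub>R d - z)"
      using nearest_stationary by blast
    define u where "u = x + s *\<^sub>R d - z"
    have nu: "norm u = D" using z by (simp add: u_def D_def)
    have "u \<bullet> (u + (1 - s) *\<^sub>R d) \<le> D * (\<eta> * e)"
      using inner_step_le[OF near c \<sigma> d model small _ _ _ z] s st t D_le nu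
      by (simp add: u_def D_def e_def algebra_simps)
    then have "D * D + (1 - s) * (u \<bullet> d) \<le> D * (\<eta> * e)"
      using nu by (simp add: inner_add_right power2_norm_eq_inner[symmetric] power2_eq_square)
    moreover have "D * (\<eta> * e + (1 - s) * m) \<le> D * D"
      using D_ge D_pos by (intro mult_left_mono) auto
    ultimately have "(1 - s) * (u \<bullet> d) \<le> (1 - s) * (- (m * D))"
      by (simp add: algebra_simps)
    \<comment> \<open>Since \<open>s < t \<le> 1\<close>, the factor \<open>1 - s\<close> is
      positive and cancels. What remains says that moving along \<open>d\<close> shrinks the
      distance to \<open>z\<close> at rate at least \<open>m\<close>.\<close>
    then have ud: "u \<bullet> d \<le> - (m * D)"
      by (subst (asm) mult_le_cancel_left_pos) (use st t in auto)
    \<comment> \<open>Just after \<open>s\<close> the distance to \<open>S\<close> lies above the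
      line, yet it is at most the distance to the fixed point \<open>z\<close>. Comparing squares to
      first order in \<open>h\<close> leaves this inequality.\<close>
    have "2 * \<kappa> * D \<le> 0"
    proof (rule le_if_le_up_to_square[of "t - s" _ _ "(norm d)\<^sup>2"])
      show "0 < t - s" using st by simp
      fix h assume h: "0 < h" "h < t - s"
      have "0 < \<theta> (s + h)"
        using max[of "s + h"] s h by (force simp: not_le[symmetric])
      moreover have "\<delta> (x + (s + h) *\<^sub>R d) \<le> norm (u + h *\<^sub>R d)"
        using infdist_le[OF z(2), of "x + (s + h) *\<^sub>R d"]
        by (simp add: u_def dist_norm algebra_simps)
      ultimately have "D - h * (m - \<kappa>) \<le> norm (u + h *\<^sub>R d)"
        by (simp add: \<theta>_def D algebra_simps)
      moreover have "0 \<le> D - h * (m - \<kappa>)"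
      proof -
        have "(s + h) * (m - \<kappa>) \<le> 1 * (m - \<kappa>)"
          using h t \<kappa> by (intro mult_right_mono) auto
        then show ?thesis using m \<kappa> by (simp add: D algebra_simps)
      qed
      ultimately have "(D - h * (m - \<kappa>))\<^sup>2 \<le> (norm (u + h *\<^sub>R d))\<^sup>2"
        by (rule power_mono)
      also have "\<dots> = D\<^sup>2 + 2 * h * (u \<bullet> d) + h\<^sup>2 * (norm d)\<^sup>2"
        by (simp add: norm_add_scaleR_squared nu)
      also have "\<dots> \<le> D\<^sup>2 + 2 * h * (- (m * D)) + h\<^sup>2 * (norm d)\<^sup>2"
        using ud h by (intro add_mono mult_left_mono) auto
      finally have "2 * h * \<kappa> * D + (h * (m - \<kappa>))\<^sup>2 \<le> h\<^sup>2 * (norm d)\<^sup>2"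
        by (simp add: power2_eq_square algebra_simps)
      then have "2 * h * \<kappa> * D \<le> h\<^sup>2 * (norm d)\<^sup>2"
        using zero_le_power2[of "h * (m - \<kappa>)"] by linarith
      then show "h * (2 * \<kappa> * D) \<le> h * 0 + (norm d)\<^sup>2 * h\<^sup>2"
        by (simp add: mult_ac)
    qed
    then show False using D_pos \<kappa> by (simp add: mult_le_0_iff)
  qed
  have "\<delta> (x + t *\<^sub>R d) \<le> e - t * m"
  proof (rule field_le_epsilon)
    fix \<epsilon> :: real assume \<epsilon>: "0 < \<epsilon>"
    define \<kappa> where "\<kappa> = min \<epsilon> (m / 2)"
    have \<kappa>: "0 < \<kappa>" "\<kappa> < m" "\<kappa> \<le> \<epsilon>" using \<epsilon> m by (auto simp: \<kappa>_def)
    have "t * \<kappa> \<le> 1 * \<epsilon>" using t \<kappa> by (intro mult_mono) auto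
    then show "\<delta> (x + t *\<^sub>R d) \<le> e - t * m + \<epsilon>"
      using *[OF \<kappa>(1,2)] unfolding right_diff_distrib by linarith
  qed
  then show ?thesis by (simp add: e_def m_def algebra_simps)
qed

section \<open>Convergence of the iterates\<close>

text \<open>A step moves the iterate by at most \<open>t k * c * \<delta> (x k)\<close> and lowers
  the distance by at least \<open>t k * (1 - \<eta>) * \<delta> (x k)\<close>. Weighting the
  distance by \<open>c / (1 - \<eta>)\<close> balances the two, and the resulting invariant makes
  the local hypotheses available at every index.\<close>

lemma iterates_converge:
  fixes x d :: "nat \<Rightarrow> real^'n" and t :: "nat \<Rightarrow> real"
  assumes step: "\<And>k. x (Suc k) = x k + t k *\<^sub>R d k"
    and c: "0 \<le> c" and \<sigma>: "0 \<le> \<sigma>" and \<eta>: "0 < \<eta>" "\<eta> < 1"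
    and t: "\<And>k. 0 < t k" "\<And>k. t k \<le> 1"
    and d: "\<And>k. x k \<in> ball a r \<Longrightarrow> norm (d k) \<le> c * \<delta> (x k)"
    and model: "\<And>k. norm (x k - a) < r / 2 \<Longrightarrow>
      norm (grad R (x k) + gram R (x k) *v d k) \<le> M * \<delta> (x k)"
    and \<tau>: "0 < \<tau>" "\<tau> < 1"
    and t_ge: "\<And>k. norm (x k - a) + norm (d k) < r / 2 \<Longrightarrow> \<tau> \<le> t k"
    and start: "norm (x 0 - a) * (1 + c / (1 - \<eta>)) < r / 2"
    and small: "M + (2 + c) * \<sigma> + L * K * ((1 + c) * (2 + c)) * norm (x 0 - a) \<le> \<eta> * \<omega>"
  shows "tends_to_zero_linearly (\<lambda>k. \<delta> (x k))"
    and "\<exists>xbar \<in> S \<inter> ball a (r / 2). x \<longlonglongrightarrow> xbar"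
proof -
  define q where "q = 1 - \<tau> * (1 - \<eta>)"
  have q: "0 < q" "q < 1"
  proof -
    have "\<tau> * (1 - \<eta>) < 1 * 1" using \<tau> \<eta> by (intro mult_strict_mono) auto
    then show "0 < q" "q < 1" using \<tau> \<eta> by (auto simp: q_def)
  qed
  define C where "C = c / (1 - \<eta>)"
  have C: "0 \<le> C" "c \<le> C" "C * (1 - \<eta>) = c"
    using c \<eta> by (auto simp: C_def pos_le_divide_eq mult_left_le)
  define \<rho> where "\<rho> = norm (x 0 - a) * (1 + C)"
  have \<rho>: "\<rho> < r / 2" using start by (simp add: \<rho>_def C_def)
  have near: "norm (x k - a) + norm (d k) < r / 2" and dk: "norm (d k) \<le> c * \<delta> (x k)"
    if "norm (x k - a) + C * \<delta> (x k) \<le> \<rho>" for k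
  proof -
    have nn: "0 \<le> C * \<delta> (x k)" using C by (simp add: infdist_nonneg)
    then have "norm (x k - a) < r / 2" using that \<rho> by simp
    then have "x k \<in> ball a r" using norm_ge_zero[of "x k - a"]
      by (simp add: dist_norm norm_minus_commute del: norm_ge_zero)
    then show dk: "norm (d k) \<le> c * \<delta> (x k)" by (rule d)
    also have "\<dots> \<le> C * \<delta> (x k)"
      using C by (intro mult_right_mono) (auto simp: infdist_nonneg)
    finally show "norm (x k - a) + norm (d k) < r / 2" using that \<rho> by simp
  qed
  have contr: "\<delta> (x (Suc k)) \<le> (1 - t k * (1 - \<eta>)) * \<delta> (x k)"
    if inv: "norm (x k - a) + C * \<delta> (x k) \<le> \<rho>" and le: "\<delta> (x k) \<le> norm (x 0 - a)" for k
  proof -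
    have "L * K * ((1 + c) * (2 + c)) * \<delta> (x k) \<le> L * K * ((1 + c) * (2 + c)) * norm (x 0 - a)"
      using le L_nonneg K_pos c by (intro mult_left_mono) auto
    then have "M + (2 + c) * \<sigma> + L * K * ((1 + c) * (2 + c)) * \<delta> (x k) \<le> \<eta> * \<omega>"
      using small by simp
    moreover have "norm (grad R (x k) + gram R (x k) *v d k) \<le> M * \<delta> (x k)"
      using near[OF inv] by (intro model) (use norm_ge_zero[of "d k"] in linarith)
    ultimately show ?thesis
      using infdist_step_le[OF near[OF inv] c \<sigma> dk[OF inv] _ _ \<eta>, of M "t k"]
      by (simp add: step t less_imp_le)
  qed
  \<comment> \<open>The second conjunct lets \<open>small\<close>, stated at
    \<open>norm (x 0 - a)\<close>, serve at all iterates. Both hold initially because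
    \<open>a\<close> is stationary.\<close>
  have inv: "norm (x k - a) + C * \<delta> (x k) \<le> \<rho> \<and> \<delta> (x k) \<le> norm (x 0 - a)" for k
  proof (induction k)
    case 0
    have "\<delta> (x 0) \<le> norm (x 0 - a)"
      using infdist_le[OF stationary_center, of "x 0"] by (simp add: dist_norm)
    then show ?case
      using C mult_left_mono[of "\<delta> (x 0)" "norm (x 0 - a)" C] by (simp add: \<rho>_def algebra_simps)
  next
    case (Suc k)
    have le: "\<delta> (x (Suc k)) \<le> (1 - t k * (1 - \<eta>)) * \<delta> (x k)" using contr Suc by blast
    have "norm (x (Suc k) - a) \<le> norm (x k - a) + t k * norm (d k)"
      using norm_triangle_ineq[of "x k - a" "t k *\<^sub>R d k"] t(1)[of k]
      by (simp add: step algebra_simps)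
    also have "\<dots> \<le> norm (x k - a) + t k * (C * (1 - \<eta>) * \<delta> (x k))"
      using dk Suc t(1)[of k] C by (intro add_left_mono mult_left_mono) auto
    finally have "norm (x (Suc k) - a) + C * \<delta> (x (Suc k))
        \<le> norm (x k - a) + t k * (C * (1 - \<eta>) * \<delta> (x k)) + C * ((1 - t k * (1 - \<eta>)) * \<delta> (x k))"
      using le C by (intro add_mono mult_left_mono) auto
    also have "\<dots> = norm (x k - a) + C * \<delta> (x k)" by (simp add: algebra_simps)
    finally have 1: "norm (x (Suc k) - a) + C * \<delta> (x (Suc k)) \<le> \<rho>" using Suc by simp
    have "0 \<le> t k * (1 - \<eta>) * \<delta> (x k)"
      using t(1)[of k] \<eta> by (simp add: infdist_nonneg)
    then have "\<delta> (x (Suc k)) \<le> \<delta> (x k)" using le by (simp add: algebra_simps)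
    then show ?case using 1 Suc by simp
  qed
  have lin: "\<delta> (x (Suc k)) \<le> q * \<delta> (x k)" for k
  proof -
    have "\<tau> * (1 - \<eta>) \<le> t k * (1 - \<eta>)"
      using near inv t_ge \<eta> by (intro mult_right_mono) auto
    then have "(1 - t k * (1 - \<eta>)) * \<delta> (x k) \<le> q * \<delta> (x k)"
      by (intro mult_right_mono) (auto simp: q_def infdist_nonneg)
    then show ?thesis using contr[of k] inv[of k] by linarith
  qed
  have pow: "\<delta> (x k) \<le> q ^ k * \<delta> (x 0)" for k
  proof (induction k)
    case (Suc k)
    have "\<delta> (x (Suc k)) \<le> q * (q ^ k * \<delta> (x 0))"
      by (rule order_trans[OF lin mult_left_mono[OF Suc]]) (use q in simp)
    then show ?case by (simp add: mult_ac)
  qed simp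
  have "(\<lambda>k. q ^ k * \<delta> (x 0)) \<longlonglongrightarrow> 0 * \<delta> (x 0)"
    using q by (intro tendsto_intros LIMSEQ_power_zero) auto
  then have lim0: "(\<lambda>k. \<delta> (x k)) \<longlonglongrightarrow> 0"
    by (intro tendsto_sandwich[of "\<lambda>_. 0" "\<lambda>k. \<delta> (x k)" sequentially "\<lambda>k. q ^ k * \<delta> (x 0)"])
      (auto simp: infdist_nonneg pow)
  then show "tends_to_zero_linearly (\<lambda>k. \<delta> (x k))"
    unfolding tends_to_zero_linearly_def using q lin by (auto simp: infdist_nonneg intro!: exI[of _ q])
  \<comment> \<open>The increments are dominated by a geometric series, so the telescoping sum
    yields a limit.\<close>
  have "summable (\<lambda>k. x (Suc k) - x k)"
  proof (rule summable_comparison_test')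
    show "summable (\<lambda>k. c * \<delta> (x 0) * q ^ k)"
      using q by (intro summable_mult summable_geometric) auto
    fix k :: nat
    have "norm (x (Suc k) - x k) = t k * norm (d k)"
      using t(1)[of k] by (simp add: step)
    also have "\<dots> \<le> 1 * (c * (q ^ k * \<delta> (x 0)))"
      using t[of k] dk[of k] inv[of k] mult_left_mono[OF pow[of k] c] by (intro mult_mono) auto
    finally show "norm (x (Suc k) - x k) \<le> c * \<delta> (x 0) * q ^ k" by (simp add: mult_ac)
  qed
  then have "(\<lambda>n. \<Sum>k<n. x (Suc k) - x k) \<longlonglongrightarrow> (\<Sum>k. x (Suc k) - x k)"
    by (rule summable_LIMSEQ)
  then have "(\<lambda>n. (x n - x 0) + x 0) \<longlonglongrightarrow> (\<Sum>k. x (Suc k) - x k) + x 0"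
    unfolding sum_lessThan_telescope by (intro tendsto_intros)
  then obtain xbar where xbar: "x \<longlonglongrightarrow> xbar" by auto
  have "(\<lambda>k. \<delta> (x k)) \<longlonglongrightarrow> \<delta> xbar"
    using xbar by (intro tendsto_infdist)
  then have "\<delta> xbar = 0" using lim0 LIMSEQ_unique by blast
  then have "xbar \<in> S"
    using in_closed_iff_infdist_zero[OF closed_stationary[OF cont_diff]] stationary_center by blast
  \<comment> \<open>The weak bound by \<open>\<rho>\<close> survives the limit, and
    \<open>\<rho> < r / 2\<close> still places it in the open ball.\<close>
  moreover have "norm (xbar - a) \<le> \<rho>"
  proof (rule tendsto_upperbound)
    show "(\<lambda>k. norm (x k - a)) \<longlonglongrightarrow> norm (xbar - a)" using xbar by (intro tendsto_intros)
    show "\<forall>\<^sub>F k in sequentially. norm (x k - a) \<le> \<rho>"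
    proof (intro always_eventually allI)
      fix k
      have "0 \<le> C * \<delta> (x k)" using C by (simp add: infdist_nonneg)
      then show "norm (x k - a) \<le> \<rho>" using inv[of k] by simp
    qed
  qed simp
  ultimately show "\<exists>xbar \<in> S \<inter> ball a (r / 2). x \<longlonglongrightarrow> xbar"
    using xbar \<rho> by (intro bexI[of _ xbar]) (auto simp: dist_norm norm_minus_commute)
qed

section \<open>Lower bound for the step size\<close>

text \<open>Mean value theorem on a segment that convexity keeps in the ball. Bounding the
  intermediate parameter by 1 gives \<open>L3\<close> in place of \<open>L3 / 2\<close>.\<close>

lemma obj_add_le:
  assumes lip: "\<And>x y. x \<in> ball a r \<Longrightarrow> y \<in> ball a r \<Longrightarrow> norm (grad R x - grad R y) \<le> L3 * norm (x - y)"
    and "0 \<le> L3" and x: "x \<in> ball a r" and xv: "x + v \<in> ball a r"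
  shows "obj R (x + v) \<le> obj R x + v \<bullet> grad R x + L3 * (norm v)\<^sup>2"
proof -
  have D: "((\<lambda>s. obj R (x + s *\<^sub>R v)) has_real_derivative v \<bullet> grad R (x + s *\<^sub>R v)) (at s)" for s
  proof -
    have *: "((\<lambda>s. R (x + s *\<^sub>R v)) has_derivative (\<lambda>h. h *\<^sub>R (Jac R (x + s *\<^sub>R v) *v v))) (at s)"
      using Jac_has_vector_derivative[OF cont_diff, of x v s UNIV] by (simp add: has_vector_derivative_def)
    have "v \<bullet> grad R w = R w \<bullet> (Jac R w *v v)" for w
      by (metis grad_def inner_transpose inner_commute)
    then show ?thesis
      unfolding obj_def power2_norm_eq_inner has_field_derivative_def
      by (auto intro!: derivative_eq_intros * ext simp: inner_commute)
  qed
  have "\<exists>s>0. s < 1 \<and> obj R (x + 1 *\<^sub>R v) - obj R (x + 0 *\<^sub>R v) = (1 - 0) * (v \<bullet> grad R (x + s *\<^sub>R v))"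
    by (rule MVT2) (use D in auto)
  then obtain s where s: "0 < s" "s < 1"
    and eq: "obj R (x + v) - obj R x = v \<bullet> grad R (x + s *\<^sub>R v)" by auto
  have "x + s *\<^sub>R v = (1 - s) *\<^sub>R x + s *\<^sub>R (x + v)" by (simp add: algebra_simps)
  then have xs: "x + s *\<^sub>R v \<in> ball a r"
    using convexD[OF convex_ball x xv, of "1 - s" s] s by simp
  have "v \<bullet> (grad R (x + s *\<^sub>R v) - grad R x) \<le> norm v * norm (grad R (x + s *\<^sub>R v) - grad R x)"
    by (rule norm_cauchy_schwarz)
  also have "\<dots> \<le> norm v * (L3 * (s * norm v))"
    using lip[OF xs x] s by (intro mult_left_mono) auto
  also have "\<dots> \<le> norm v * (L3 * (1 * norm v))"
    using s \<open>0 \<le> L3\<close> by (intro mult_left_mono mult_right_mono) auto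
  finally show ?thesis using eq by (simp add: inner_diff_right power2_eq_square mult_ac)
qed

text \<open>Entries of \<open>gram R x\<close> are inner products of Jacobian columns of norm at
  most \<open>K\<close>, and zeroing entries keeps the bound. What matters is that it is the same
  for all iterates.\<close>

lemma spec_norm_Hmat_le:
  assumes x: "x \<in> ball a r"
  shows "spec_norm (Hmat R P x) \<le> real CARD('n) * real CARD('n) * K\<^sup>2"
  unfolding spec_norm_def
proof (rule onorm_le_matrix_component)
  fix i j
  have "\<bar>gram R x $ i $ j\<bar> = \<bar>(Jac R x *v axis i 1) \<bullet> (Jac R x *v axis j 1)\<bar>"
    unfolding gram_inner[symmetric]
    by (simp add: matrix_vector_mult_basis column_def inner_axis' )
  also have "\<dots> \<le> (K * norm (axis i 1 :: real^'n)) * (K * norm (axis j 1 :: real^'n))"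
    using K_pos
    by (intro order_trans[OF Cauchy_Schwarz_ineq2] mult_mono norm_Jac_vector_le x) auto
  finally have "\<bar>gram R x $ i $ j\<bar> \<le> K\<^sup>2"
    by (simp add: power2_eq_square)
  then show "\<bar>Hmat R P x $ i $ j\<bar> \<le> K\<^sup>2"
    by (simp add: Hmat_def block_diag_def)
qed

text \<open>For \<open>s * L3 \<le> (1 - c) * \<kappa>\<close> the quadratic term of
  \<open>obj_add_le\<close> is absorbed by the share \<open>1 - c\<close> of the descent that the
  decrease test leaves over.\<close>

lemma admissible_step_of_descent:
  assumes lip: "\<And>x y. x \<in> ball a r \<Longrightarrow> y \<in> ball a r \<Longrightarrow> norm (grad R x - grad R y) \<le> L3 * norm (x - y)"
    and L3: "0 < L3" and c: "c < 1" and near: "norm (x - a) + norm d < r"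
    and descent: "d \<bullet> grad R x \<le> - (\<kappa> * (norm d)\<^sup>2)"
    and s: "0 < s" "s \<le> 1" "s \<le> 1 / \<gamma>" "s \<le> (1 - c) * \<kappa> / L3"
  shows "admissible_step R c \<gamma> x d s"
proof -
  have "norm (x + s *\<^sub>R d - a) \<le> norm (x - a) + s * norm d"
    using norm_triangle_ineq[of "x - a" "s *\<^sub>R d"] s by (simp add: algebra_simps)
  also have "\<dots> \<le> norm (x - a) + 1 * norm d"
    using s by (intro add_left_mono mult_right_mono) auto
  finally have xs: "x + s *\<^sub>R d \<in> ball a r"
    using near by (simp add: dist_norm norm_minus_commute)
  have x: "x \<in> ball a r"
    using near norm_ge_zero[of d] by (simp add: dist_norm norm_minus_commute del: norm_ge_zero)
  have "s * L3 \<le> (1 - c) * \<kappa>" using s L3 by (simp add: field_simps)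
  then have "s * L3 * (norm d)\<^sup>2 \<le> (1 - c) * \<kappa> * (norm d)\<^sup>2"
    by (intro mult_right_mono) auto
  also have "\<dots> \<le> - ((1 - c) * (d \<bullet> grad R x))"
    using mult_left_mono[OF descent, of "1 - c"] c by simp
  finally have "s * (s * L3 * (norm d)\<^sup>2) \<le> s * - ((1 - c) * (d \<bullet> grad R x))"
    using s by (intro mult_left_mono) auto
  then have "s * (d \<bullet> grad R x) + L3 * (norm (s *\<^sub>R d))\<^sup>2 \<le> c * s * (d \<bullet> grad R x)"
    using s by (simp add: power2_eq_square algebra_simps)
  then have "obj R (x + s *\<^sub>R d) \<le> obj R x + c * s * (d \<bullet> grad R x)"
    using obj_add_le[OF lip _ x xs] L3 by simp
  then show ?thesis using s by (simp add: admissible_step_def)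
qed

lemma norm_grad_le_infdist:
  assumes lip: "\<And>x y. x \<in> ball a r \<Longrightarrow> y \<in> ball a r \<Longrightarrow> norm (grad R x - grad R y) \<le> L3 * norm (x - y)"
    and x: "norm (x - a) < r / 2"
  shows "norm (grad R x) \<le> L3 * \<delta> x"
proof -
  obtain z where z: "z \<in> ball a r" "z \<in> S" "\<delta> x = norm (x - z)"
    using nearest_stationary[OF x] by blast
  have "x \<in> ball a r"
    using x norm_ge_zero[of "x - a"] by (simp add: dist_norm norm_minus_commute del: norm_ge_zero)
  then show ?thesis using lip[OF _ z(1)] z by (simp add: stationary_def grad_def)
qed

end

section \<open>Verification of the convergence conditions for the algorithm\<close>

theorem theorem3:
  fixes R :: "real^'n \<Rightarrow> real^'m" and P :: "'n set set"
    and c b \<eta>hat lmin L \<omega> \<sigma> r L2 L3 L4 c1 \<mu>max \<rho>max \<eta> \<epsilon> :: real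
    and xstar :: "real^'n" and x d :: "nat \<Rightarrow> real^'n" and l \<beta> t \<rho> :: "nat \<Rightarrow> real"
  defines "S \<equiv> stationary R"
  assumes "xstar \<in> S" and "r > 0"
    and "cont_diff R"
    and "\<And>x y. spec_norm (Jac R x - Jac R y) \<le> L * norm (x - y)"
    and "\<omega> > 0"
    and "\<And>x. x \<in> ball xstar r \<Longrightarrow> \<omega> * infdist x S \<le> norm (transpose (Jac R x) *v R x)"
    and "\<sigma> > 0"
    and "\<And>x z. x \<in> ball xstar r \<Longrightarrow> z \<in> ball xstar r \<inter> S \<Longrightarrow>
           norm (transpose (Jac R x - Jac R z) *v R z) \<le> \<sigma> * norm (x - z)"
    and "partition_on UNIV P"
    and "0 < c" and "c < 1" and "0 < b" and "b < 1" and "0 \<le> \<eta>hat" and "\<eta>hat < 1"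
    and "0 \<le> lmin" and "lmin < l 0"
    and "lms_sequence R P c b \<eta>hat lmin x l \<beta> d t"
    and "bdd_above (range (\<lambda>k. lms_mu R P b (l k) (x k)))"
    and "\<mu>max = (SUP k. lms_mu R P b (l k) (x k))"
    and "\<And>k. norm (grad R (x k) + (gram R (x k) + lms_mu R P b (l k) (x k) *\<^sub>R mat 1) *v d k)
              \<le> \<rho> k * norm (grad R (x k))"
    and "bdd_above (range \<rho>)"
    and "\<rho>max = (SUP k. \<rho> k)"
    and "L2 > 0" and "L3 > 0" and "L4 > 0"
    and "\<And>x y. x \<in> ball xstar r \<Longrightarrow> y \<in> ball xstar r \<Longrightarrow> norm (R x - R y) \<le> L2 * norm (x - y)"
    and "\<And>x y. x \<in> ball xstar r \<Longrightarrow> y \<in> ball xstar r \<Longrightarrow>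
           norm (grad R x - grad R y) \<le> L3 * norm (x - y)"
    and "\<And>x y. x \<in> ball xstar r \<Longrightarrow> y \<in> ball xstar r \<Longrightarrow>
           norm (grad R x - grad R y - gram R x *v (x - y))
             \<le> L4 * (norm (x - y))\<^sup>2 + norm (transpose (Jac R x - Jac R y) *v R y)"
    and "c1 > 0"
    and "\<And>k. x k \<in> ball xstar r \<Longrightarrow> norm (d k) \<le> c1 * infdist (x k) S"
    and "0 < \<eta>" and "\<eta> < 1"
    and "\<eta> * \<omega> > \<mu>max * c1 + L3 * \<rho>max + (2 + c1) * \<sigma>"
    and "\<epsilon> = min ((\<eta> * \<omega> - (c1 * \<mu>max + \<rho>max * L3 + (2 + c1) * \<sigma>))
                     / (L4 * c1\<^sup>2 + L * L2 * (1 + c1) * (2 + c1)))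
                  (1 / 2 * (r * (1 - \<eta>) / (1 + c1 - \<eta>)))"
    and "x 0 \<in> ball xstar \<epsilon>"
  shows "tends_to_zero_linearly (\<lambda>k. infdist (x k) S)
       \<and> (\<exists>xbar \<in> S \<inter> ball xstar (r / 2). x \<longlonglongrightarrow> xbar)"
proof -
  note lip_J = assms(5) and error = assms(7) and resid = assms(9)
  note part = assms(10) and cb = assms(11-14) and lms = assms(19)
  note lip_R = assms(28) and lip_g = assms(29) and d_le = assms(32)
  interpret local_regularity R xstar r L \<omega> \<sigma> L2
    using assms(2-9) assms(25) lip_R unfolding S_def by unfold_locales (auto simp: grad_def)
  let ?\<mu> = "\<lambda>k. lms_mu R P b (l k) (x k)"
  have \<mu>_le: "?\<mu> k \<le> \<mu>max" for k
    unfolding assms(21) by (rule cSUP_upper[OF UNIV_I assms(20)])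
  have \<rho>_le: "\<rho> k \<le> \<rho>max" for k
    unfolding assms(24) by (rule cSUP_upper[OF UNIV_I assms(23)])
  have l_nonneg: "0 \<le> l k" for k
    using lms_sequence_l_nonneg[OF lms] assms(17,18) by simp
  have \<mu>_ge: "1 \<le> ?\<mu> k" for k
    using lms_mu_ge_1[OF l_nonneg] cb by blast
  have step: "x (Suc k) = x k + t k *\<^sub>R d k"
    and adm: "admissible_step R c (lms_gamma R P (\<beta> k) (x k)) (x k) (d k) (t k)"
    and largest: "\<And>s. admissible_step R c (lms_gamma R P (\<beta> k) (x k)) (x k) (d k) s \<Longrightarrow> s \<le> t k"
    and dir: "(Hmat R P (x k) + ?\<mu> k *\<^sub>R mat 1) *v d k
      = (\<beta> k *\<^sub>R Bmat R P (x k) - mat 1) *v grad R (x k)"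
    and \<beta>: "spec_norm (\<beta> k *\<^sub>R Bmat R P (x k)) \<le> b * ?\<mu> k / (spec_norm (Hmat R P (x k)) + ?\<mu> k)" for k
    using lms unfolding lms_sequence_def Let_def by blast+
  \<comment> \<open>\<open>L3 * \<rho>max\<close> stems from the relative residual of the full
    system, \<open>\<mu>max * c1\<close> from taking the damping term out of it.\<close>
  define M where "M = \<mu>max * c1 + L3 * \<rho>max"
  have model: "norm (grad R (x k) + gram R (x k) *v d k) \<le> M * infdist (x k) S"
    if near: "norm (x k - xstar) < r / 2" for k
  proof -
    have xk: "x k \<in> ball xstar r"
      using near norm_ge_zero[of "x k - xstar"]
      by (simp add: dist_norm norm_minus_commute del: norm_ge_zero)
    have e: "0 \<le> infdist (x k) S" by (rule infdist_nonneg)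
    have g: "norm (grad R (x k)) \<le> L3 * infdist (x k) S"
      unfolding S_def by (rule norm_grad_le_infdist[OF lip_g near])
    have "\<rho> k * norm (grad R (x k)) \<le> L3 * \<rho>max * infdist (x k) S"
    \<comment> \<open>At distance zero the gradient vanishes by \<open>g\<close>. Otherwise the
      error bound makes it nonzero, so the residual assumption yields
      \<open>0 \<le> \<rho> k\<close>.\<close>
    proof (cases "infdist (x k) S = 0")
      case True
      then show ?thesis using g by simp
    next
      case False
      then have "0 < \<omega> * infdist (x k) S" using e \<omega>_pos by simp
      also have "\<dots> \<le> norm (grad R (x k))" using error[OF xk] by (simp add: grad_def)
      finally have pos: "0 < norm (grad R (x k))" .
      have "0 \<le> \<rho> k * norm (grad R (x k))" by (rule order_trans[OF norm_ge_zero assms(22)])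
      then have "0 \<le> \<rho> k" using pos by (simp add: zero_le_mult_iff)
      then have "\<rho> k * norm (grad R (x k)) \<le> \<rho>max * (L3 * infdist (x k) S)"
        using \<rho>_le[of k] g by (intro mult_mono) auto
      then show ?thesis by (simp add: mult_ac)
    qed
    moreover have "norm (?\<mu> k *\<^sub>R d k) \<le> \<mu>max * (c1 * infdist (x k) S)"
      using \<mu>_le[of k] \<mu>_ge[of k] d_le[OF xk] by (simp add: mult_mono)
    moreover have "grad R (x k) + (gram R (x k) + ?\<mu> k *\<^sub>R mat 1) *v d k
        = (grad R (x k) + gram R (x k) *v d k) + ?\<mu> k *\<^sub>R d k"
      by (simp add: matrix_vector_mult_add_rdistrib scaleR_matrix_vector_assoc[symmetric])
    then have "norm (grad R (x k) + gram R (x k) *v d k)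
        \<le> \<rho> k * norm (grad R (x k)) + norm (?\<mu> k *\<^sub>R d k)"
      using assms(22)[of k]
        norm_triangle_ineq4[of "(grad R (x k) + gram R (x k) *v d k) + ?\<mu> k *\<^sub>R d k" "?\<mu> k *\<^sub>R d k"]
      by (simp add: add.assoc)
    ultimately show ?thesis by (simp add: M_def algebra_simps)
  qed
  define h where "h = real CARD('n) * real CARD('n) * L2\<^sup>2"
  have h: "0 \<le> h" by (simp add: h_def)
  have \<mu>max: "0 < \<mu>max" using \<mu>_le[of 0] \<mu>_ge[of 0] by linarith
  \<comment> \<open>The descent estimate is in terms of the gradient norm;
    \<open>norm (d k) \<le> (1 + b) * norm (grad R (x k))\<close>, from a damping of at least 1,
    converts it to \<open>norm (d k)\<close> and accounts for the square.\<close>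
  define \<kappa> where "\<kappa> = (1 - b) / ((h + \<mu>max) * (1 + b)\<^sup>2)"
  have \<kappa>: "0 < \<kappa>" using cb h \<mu>max by (simp add: \<kappa>_def)
  have descent: "d k \<bullet> grad R (x k) \<le> - (\<kappa> * (norm (d k))\<^sup>2)" if xk: "x k \<in> ball xstar r" for k
  proof -
    let ?H = "Hmat R P (x k)" and ?g = "grad R (x k)"
    have H: "transpose ?H = ?H" "\<And>y. 0 \<le> y \<bullet> (?H *v y)"
      unfolding Hmat_def
      by (simp_all add: transpose_block_diag transpose_gram block_diag_psd[OF part] gram_inner)
    have \<mu>: "0 < ?\<mu> k" using \<mu>_ge[of k] by linarith
    note dd = damped_direction_descent[OF H \<mu> cb(3,4) \<beta> dir]
    have "(1 + b) / ?\<mu> k \<le> 1 + b"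
      using \<mu>_ge[of k] cb by (simp add: divide_le_eq mult_left_le)
    then have "norm (d k) \<le> (1 + b) * norm ?g"
      by (intro order_trans[OF dd(2)] mult_right_mono) auto
    then have "(norm (d k))\<^sup>2 \<le> (1 + b)\<^sup>2 * (norm ?g)\<^sup>2"
      by (metis power_mono norm_ge_zero power_mult_distrib)
    then have "\<kappa> * (norm (d k))\<^sup>2 \<le> \<kappa> * ((1 + b)\<^sup>2 * (norm ?g)\<^sup>2)"
      using \<kappa> by (intro mult_left_mono) auto
    also have "\<dots> = (1 - b) / (h + \<mu>max) * (norm ?g)\<^sup>2"
      using cb by (simp add: \<kappa>_def)
    also have "\<dots> \<le> (1 - b) / (spec_norm ?H + ?\<mu> k) * (norm ?g)\<^sup>2"
      using spec_norm_Hmat_le[OF xk, of P] \<mu>_le[of k] \<mu> cb spec_norm_nonneg[of ?H]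
      by (intro mult_right_mono divide_left_mono mult_pos_pos) (auto simp: h_def)
    finally show ?thesis using dd(1) by linarith
  qed
  \<comment> \<open>The first entry bounds the cap \<open>1 / \<gamma>\<close> from below and is
    less than 1 because \<open>0 < b\<close>; the second is the threshold of
    \<open>admissible_step_of_descent\<close>.\<close>
  define \<tau> where "\<tau> = min (1 / (1 + b)) ((1 - c) * \<kappa> / L3)"
  have \<tau>: "0 < \<tau>" "\<tau> < 1"
    using cb \<kappa> assms(26) by (auto simp: \<tau>_def min_less_iff_disj)
  have t_ge: "\<tau> \<le> t k" if near: "norm (x k - xstar) + norm (d k) < r / 2" for k
  proof (rule largest)
    have xk: "x k \<in> ball xstar r"
      using near norm_ge_zero[of "d k"] norm_ge_zero[of "x k - xstar"]
      by (simp add: dist_norm norm_minus_commute del: norm_ge_zero)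
    have near': "norm (x k - xstar) + norm (d k) < r" using near assms(3) by linarith
    have "b * ?\<mu> k \<le> b * (spec_norm (Hmat R P (x k)) + ?\<mu> k)"
      using cb by (intro mult_left_mono) (auto simp: spec_norm_nonneg)
    then have "b * ?\<mu> k / (spec_norm (Hmat R P (x k)) + ?\<mu> k) \<le> b"
      using \<mu>_ge[of k] spec_norm_nonneg[of "Hmat R P (x k)"] by (simp add: pos_divide_le_eq)
    then have "spec_norm (\<beta> k *\<^sub>R Bmat R P (x k)) \<le> b" using \<beta>[of k] by linarith
    note \<gamma> = lms_gamma_bounds[OF this cb(4)]
    have "1 / (1 + b) \<le> 1 / lms_gamma R P (\<beta> k) (x k)"
      using \<gamma> cb by (intro divide_left_mono mult_pos_pos) auto
    then show "admissible_step R c (lms_gamma R P (\<beta> k) (x k)) (x k) (d k) \<tau>"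
      using \<tau>
      by (intro admissible_step_of_descent[OF lip_g assms(26) cb(2) near' descent[OF xk]])
        (auto simp: \<tau>_def)
  qed
  have t: "0 < t k" "t k \<le> 1" for k
    using adm[of k] by (auto simp: admissible_step_def)
  have n: "norm (x 0 - xstar) < \<epsilon>"
    using assms(37) by (simp add: dist_norm norm_minus_commute)
  have start: "norm (x 0 - xstar) * (1 + c1 / (1 - \<eta>)) < r / 2"
  proof -
    have "norm (x 0 - xstar) < 1 / 2 * (r * (1 - \<eta>) / (1 + c1 - \<eta>))"
      using n unfolding assms(36) by simp
    \<comment> \<open>Here \<open>1 + c1 / (1 - \<eta>) = (1 + c1 - \<eta>) / (1 - \<eta>)\<close>,
      which turns the second entry of \<open>\<epsilon>\<close> into exactly
      \<open>r / 2\<close>.\<close>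
    then show ?thesis using assms(31,34) by (simp add: field_simps)
  qed
  have small: "M + (2 + c1) * \<sigma> + L * L2 * ((1 + c1) * (2 + c1)) * norm (x 0 - xstar) \<le> \<eta> * \<omega>"
  proof -
    let ?D = "L4 * c1\<^sup>2 + L * L2 * (1 + c1) * (2 + c1)"
    have D: "0 < L4 * c1\<^sup>2" "0 \<le> L * L2 * (1 + c1) * (2 + c1)"
      using assms(25,27,31) L_nonneg by auto
    have "norm (x 0 - xstar) \<le> (\<eta> * \<omega> - (c1 * \<mu>max + \<rho>max * L3 + (2 + c1) * \<sigma>)) / ?D"
      using n unfolding assms(36) by simp
    then have "norm (x 0 - xstar) * ?D \<le> \<eta> * \<omega> - (c1 * \<mu>max + \<rho>max * L3 + (2 + c1) * \<sigma>)"
      using D by (simp add: pos_le_divide_eq)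
    moreover have "0 \<le> norm (x 0 - xstar) * (L4 * c1\<^sup>2)" using D by simp
    ultimately show ?thesis by (simp add: M_def algebra_simps)
  qed
  note conv = iterates_converge[OF step less_imp_le[OF assms(31)] less_imp_le[OF assms(8)] assms(33,34)
      t d_le[unfolded S_def] model[unfolded S_def] \<tau> t_ge start small]
  show ?thesis using conv unfolding S_def by blast
qed

end
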